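(* There is a constant $C>0$ such that for all integers $d\geq 3$ and $n\geq 2$ there exist nonzero tensors $v\in(\mathbb{C}^n)^{\otimes d}$ with $0\notin\Delta_G(v)$ but $\operatorname{dist}(0,\Delta_G(v))\leq 2^{-Cdn}$. That is, the gap for $d$-tensor scaling satisfies $\gamma_G(\pi_{n,d})\leq 2^{-Cdn}$.
   Context: Let $G=\mathrm{SL}(n)^d$ act on $(\mathbb{C}^n)^{\otimes d}$ via $\pi_{n,d}(g_1,\dots,g_d)=g_1\otimes\cdots\otimes g_d$. For nonzero $w\in(\mathbb{C}^n)^{\otimes d}$ and $k\in[d]$, let $M_k$ be the $k$-th flattening of $w/\|w\|$, i.e. the $n\times n^{d-1}$ matrix whose rows are indexed by the $k$-th tensor index, and let $\rho_k(w):=M_kM_k^\dagger$ (the $k$-th quantum marginal). For a Hermitian matrix $H$ let $\operatorname{spec}(H)\in\mathbb{R}^n$ denote its eigenvalues in decreasing order. The moment polytope of nonzero $v$ is $\Delta_G(v):=\{(\operatorname{spec}\rho_1(w)-\tfrac1n\mathbb{1}_n,\dots,\operatorname{spec}\rho_d(w)-\tfrac1n\mathbb{1}_n): w\in\overline{G\cdot v},\ w\neq 0\}\subseteq(\mathbb{R}^n)^d$, where $\overline{G\cdot v}$ is the closure of the orbit and $\mathbb{1}_n$ the all-ones vector. The gap is $\gamma_G(\pi_{n,d}):=\min\{\operatorname{dist}(0,\Delta_G(v)): v\neq0,\ 0\notin\Delta_G(v)\}$. *)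

theory Defs
  imports "HOL-Analysis.Function_Topology" "Jordan_Normal_Form.Schur_Decomposition"
begin

text \<open>
  Both \<open>n\<close> and \<open>d\<close> are quantified inside the main statement, so all objects live in explicit
  carriers. A tensor of order \<open>d\<close> over \<open>\<complex>\<^sup>n\<close> is its coordinate function on multi-indices, which
  are lists of length \<open>d\<close> with entries below \<open>n\<close>; it vanishes off these multi-indices. Tensor
  legs and coordinates are numbered from \<open>0\<close>.
\<close>

definition multi_indices :: "nat \<Rightarrow> nat \<Rightarrow> nat list set" where
  "multi_indices n d = {x. length x = d \<and> set x \<subseteq> {..<n}}"

definition tensors :: "nat \<Rightarrow> nat \<Rightarrow> (nat list \<Rightarrow> complex) set" where
  "tensors n d = {w. \<forall>x. x \<notin> multi_indices n d \<longrightarrow> w x = 0}"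

definition zero_tensor :: "nat list \<Rightarrow> complex" where
  "zero_tensor = (\<lambda>_. 0)"

definition tensor_norm :: "nat \<Rightarrow> nat \<Rightarrow> (nat list \<Rightarrow> complex) \<Rightarrow> real" where
  "tensor_norm n d w = sqrt (\<Sum>x\<in>multi_indices n d. (cmod (w x))\<^sup>2)"

text \<open>Only the matrices \<open>g k\<close> with \<open>k < d\<close> matter below.\<close>

definition SL_tuples :: "nat \<Rightarrow> nat \<Rightarrow> (nat \<Rightarrow> complex mat) set" where
  "SL_tuples n d = {g. \<forall>k<d. g k \<in> carrier_mat n n \<and> det (g k) = 1}"

text \<open>The coordinates of \<open>(g 0 \<otimes> \<dots> \<otimes> g (d - 1)) v\<close>.\<close>

definition tensor_action ::
    "nat \<Rightarrow> nat \<Rightarrow> (nat \<Rightarrow> complex mat) \<Rightarrow> (nat list \<Rightarrow> complex) \<Rightarrow> nat list \<Rightarrow> complex" where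
  "tensor_action n d g v = (\<lambda>x. if x \<in> multi_indices n d
     then \<Sum>y\<in>multi_indices n d. (\<Prod>k<d. g k $$ (x ! k, y ! k)) * v y else 0)"

definition tensor_orbit ::
    "nat \<Rightarrow> nat \<Rightarrow> (nat list \<Rightarrow> complex) \<Rightarrow> (nat list \<Rightarrow> complex) set" where
  "tensor_orbit n d v = (\<lambda>g. tensor_action n d g v) ` SL_tuples n d"

text \<open>
  The \<open>n \<times> n\<^bsup>d-1\<^esup>\<close> matrix whose row index is the \<open>k\<close>-th tensor index; the columns are the
  remaining \<open>d - 1\<close> indices, in the order in which \<^const>\<open>List.n_lists\<close> enumerates them.
\<close>

definition flattening :: "nat \<Rightarrow> nat \<Rightarrow> nat \<Rightarrow> (nat list \<Rightarrow> complex) \<Rightarrow> complex mat" where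
  "flattening n d k w = mat n (n ^ (d - 1))
     (\<lambda>(i, j). let c = List.n_lists (d - 1) [0..<n] ! j in w (take k c @ i # drop k c))"

definition marginal :: "nat \<Rightarrow> nat \<Rightarrow> nat \<Rightarrow> (nat list \<Rightarrow> complex) \<Rightarrow> complex mat" where
  "marginal n d k w =
     (let M = flattening n d k (\<lambda>x. w x / complex_of_real (tensor_norm n d w))
      in M * mat_adjoint M)"

text \<open>
  Eigenvalues with multiplicity, in decreasing order. This is meant for Hermitian matrices,
  all of whose eigenvalues are real, so that \<^const>\<open>Re\<close> is only a type conversion.
\<close>

definition spec :: "complex mat \<Rightarrow> real list" where
  "spec H = rev (sorted_list_of_multiset (image_mset Re (proots (char_poly H))))"

text \<open>
  A point of \<open>(\<real>\<^sup>n)\<^sup>d\<close> is a function \<open>p\<close> with \<open>p k i\<close> the \<open>i\<close>-th coordinate of the \<open>k\<close>-th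
  component, and \<open>p k i = 0\<close> unless \<open>k < d\<close> and \<open>i < n\<close>.
\<close>

definition moment_point :: "nat \<Rightarrow> nat \<Rightarrow> (nat list \<Rightarrow> complex) \<Rightarrow> nat \<Rightarrow> nat \<Rightarrow> real" where
  "moment_point n d w =
     (\<lambda>k i. if k < d \<and> i < n then spec (marginal n d k w) ! i - 1 / real n else 0)"

definition zero_point :: "nat \<Rightarrow> nat \<Rightarrow> real" where
  "zero_point = (\<lambda>_ _. 0)"

text \<open>
  The closure is taken in the product topology on functions. All tensors of a given format
  vanish off one finite set, and on them this is the Euclidean topology.
\<close>

definition moment_polytope ::
    "nat \<Rightarrow> nat \<Rightarrow> (nat list \<Rightarrow> complex) \<Rightarrow> (nat \<Rightarrow> nat \<Rightarrow> real) set" where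
  "moment_polytope n d v = moment_point n d ` (closure (tensor_orbit n d v) - {zero_tensor})"

definition dist_from_zero :: "nat \<Rightarrow> nat \<Rightarrow> (nat \<Rightarrow> nat \<Rightarrow> real) set \<Rightarrow> real" where
  "dist_from_zero n d P = (INF p\<in>P. sqrt (\<Sum>k<d. \<Sum>i<n. (p k i)\<^sup>2))"

text \<open>
  The minimum is written as an infimum, which has the same value whenever the minimum exists.
\<close>

definition gap :: "nat \<Rightarrow> nat \<Rightarrow> real" where
  "gap n d = Inf {dist_from_zero n d (moment_polytope n d v) | v.
     v \<in> tensors n d \<and> v \<noteq> zero_tensor \<and> zero_point \<notin> moment_polytope n d v}"

end

theory Submission
  imports Defs
begin

text \<open>
  Let real weights \<open>lam k a\<close>, with \<open>\<Sum>a. lam k a = 0\<close> for every leg \<open>k\<close>, satisfy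
  \<open>\<Sum>k. lam k (x ! k) \<ge> c > 0\<close> for every \<open>x\<close> in the support of \<open>v\<close>. Unitary matrices make a given
  group element triangular for the order of the weights, which preserves this inequality for the
  support; hence for every tensor in the orbit of \<open>v\<close>, and so for every nonzero one in the orbit
  closure, the marginals stay away from the multiples of the identity, and \<open>0\<close> is not in the moment
  polytope. If moreover no two elements of the support differ in just one leg, the marginals of \<open>v\<close>
  are diagonal, and the distance of \<open>0\<close> from the polytope is at most their deviation from uniformity.
  It remains to find supports with such weights \<open>lam\<close> on which some amplitudes have marginals that are
  uniform up to \<open>2\<^bsup>-Cdn\<^esup>\<close>. The amplitudes form a ladder in which each step doubles, and the
  error sits at its lowest step. For \<open>d < 8\<close> a ladder of length \<open>n - 1\<close> suffices; for \<open>d \<ge> 8\<close>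
  about \<open>d / 6\<close> ladders of length \<open>n - 1\<close>, living in disjoint sets of legs, are joined to a single one.
\<close>

section \<open>Sums over multi-indices\<close>

lemma finite_multi_indices: "finite (multi_indices n d)"
proof -
  have "multi_indices n d = {xs. set xs \<subseteq> {..<n} \<and> length xs = d}"
    by (auto simp: multi_indices_def)
  then show ?thesis
    by (simp add: finite_lists_length_eq)
qed

lemma multi_indices_nth_less: "x \<in> multi_indices n d \<Longrightarrow> k < d \<Longrightarrow> x ! k < n"
  by (auto simp: multi_indices_def dest: nth_mem)

lemma multi_indices_Suc:
  "multi_indices n (Suc d) = (\<lambda>(a, x). x @ [a]) ` ({..<n} \<times> multi_indices n d)"
proof (intro equalityI subsetI)
  fix x assume "x \<in> multi_indices n (Suc d)"
  then have x: "length x = Suc d" "set x \<subseteq> {..<n}"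
    by (auto simp: multi_indices_def)
  then have "x = butlast x @ [last x]"
    by (metis append_butlast_last_id length_0_conv nat.distinct(1))
  moreover have "last x \<in> {..<n}"
    using x by (metis last_in_set length_0_conv nat.distinct(1) subsetD)
  moreover have "butlast x \<in> multi_indices n d"
    using x by (auto simp: multi_indices_def dest: in_set_butlastD)
  ultimately show "x \<in> (\<lambda>(a, x). x @ [a]) ` ({..<n} \<times> multi_indices n d)"
    by (metis (mono_tags, lifting) SigmaI case_prod_conv image_eqI)
qed (auto simp: multi_indices_def)

lemma sum_multi_indices_prod:
  fixes f :: "nat \<Rightarrow> nat \<Rightarrow> 'a::comm_semiring_1"
  shows "(\<Sum>x\<in>multi_indices n d. \<Prod>k<d. f k (x ! k)) = (\<Prod>k<d. \<Sum>a<n. f k a)"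
proof (induction d)
  case 0
  have "multi_indices n 0 = {[]}"
    by (auto simp: multi_indices_def)
  then show ?case by simp
next
  case (Suc d)
  have "(\<Sum>x\<in>multi_indices n (Suc d). \<Prod>k<Suc d. f k (x ! k))
      = (\<Sum>(a, x)\<in>{..<n} \<times> multi_indices n d. \<Prod>k<Suc d. f k ((x @ [a]) ! k))"
    unfolding multi_indices_Suc
    by (subst sum.reindex) (auto simp: inj_on_def case_prod_beta)
  also have "\<dots> = (\<Sum>a<n. \<Sum>x\<in>multi_indices n d. (\<Prod>k<d. f k (x ! k)) * f d a)"
    unfolding sum.cartesian_product[symmetric]
    by (intro sum.cong refl) (auto simp: multi_indices_def nth_append intro!: prod.cong arg_cong2[of _ _ _ _ "(*)"])
  also have "\<dots> = (\<Prod>k<d. \<Sum>a<n. f k a) * (\<Sum>a<n. f d a)"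
    unfolding Suc[symmetric] by (simp add: sum_distrib_left sum_distrib_right)
  finally show ?case by simp
qed

subsection \<open>Unitary triangularisation\<close>

definition orthonormal_rows :: "nat \<Rightarrow> (nat \<Rightarrow> nat \<Rightarrow> complex) \<Rightarrow> bool" where
  "orthonormal_rows n h \<longleftrightarrow>
     (\<forall>a<n. \<forall>b<n. (\<Sum>i<n. h a i * cnj (h b i)) = (if a = b then 1 else 0))"

text \<open>The hypothesis makes the conjugate transpose a right inverse; for a square matrix it is
  then a left inverse too.\<close>

lemma orthonormal_rows_columns:
  assumes h: "orthonormal_rows n h" and "a < n" "b < n"
  shows "(\<Sum>i<n. h i a * cnj (h i b)) = (if a = b then 1 else 0)"
proof -
  define A where "A = mat n n (\<lambda>(i, j). h i j)"
  define B where "B = mat n n (\<lambda>(i, j). cnj (h j i))"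
  have AB: "A \<in> carrier_mat n n" "B \<in> carrier_mat n n"
    by (auto simp: A_def B_def)
  have "A * B = 1\<^sub>m n"
    by (rule eq_matI)
      (use h in \<open>auto simp: A_def B_def scalar_prod_def orthonormal_rows_def lessThan_atLeast0\<close>)
  then have "B * A = 1\<^sub>m n"
    by (rule mat_mult_left_right_inverse[OF AB])
  then have "(B * A) $$ (b, a) = (1\<^sub>m n) $$ (b, a)"
    by simp
  then show ?thesis
    using assms by (auto simp: A_def B_def scalar_prod_def lessThan_atLeast0 mult.commute)
qed

text \<open>These are \<open>n - 1\<close> linear conditions on \<open>n\<close> unknowns: with row
  \<open>a\<close> of the coefficient matrix set to zero the determinant vanishes, and a kernel
  vector is normalised. The pairing is bilinear, so orthogonality to a row is obtained by passing
  the conjugated row as \<open>c b\<close>.\<close>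

lemma exists_unit_vector_orthogonal:
  fixes c :: "nat \<Rightarrow> nat \<Rightarrow> complex"
  assumes a: "a < n"
  shows "\<exists>u. (\<Sum>i<n. u i * cnj (u i)) = 1 \<and> (\<forall>b<n. b \<noteq> a \<longrightarrow> (\<Sum>i<n. u i * c b i) = 0)"
proof -
  define A where "A = mat n n (\<lambda>(b, i). if b = a then 0 else c b i)"
  have A: "A \<in> carrier_mat n n" by (simp add: A_def)
  have "A = mat\<^sub>r n n (\<lambda>i. if i = a then 0\<^sub>v n else row A i)"
    by (rule eq_matI) (auto simp: A_def)
  moreover have "det (mat\<^sub>r n n (\<lambda>i. if i = a then 0\<^sub>v n else row A i)) = 0"
    by (rule det_row_0[OF a]) (simp add: A_def)
  ultimately have "det A = 0"
    by simp
  then obtain v where v: "v \<in> carrier_vec n" "v \<noteq> 0\<^sub>v n" "A *\<^sub>v v = 0\<^sub>v n"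
    using det_0_iff_vec_prod_zero[OF A] by blast
  have orth: "(\<Sum>i<n. v $ i * c b i) = 0" if "b < n" "b \<noteq> a" for b
  proof -
    have "(A *\<^sub>v v) $ b = 0" using v(3) that by simp
    then show ?thesis
      using that v(1) A by (auto simp: A_def scalar_prod_def lessThan_atLeast0 mult.commute)
  qed
  define s where "s = sqrt (\<Sum>i<n. (cmod (v $ i))\<^sup>2)"
  obtain i where i: "i < n" "v $ i \<noteq> 0"
    using v by (metis carrier_vecD eq_vecI index_zero_vec(1) index_zero_vec(2))
  have "0 < (\<Sum>i<n. (cmod (v $ i))\<^sup>2)"
    using i by (intro sum_pos2[of _ i]) auto
  then have s: "s > 0" "s\<^sup>2 = (\<Sum>i<n. (cmod (v $ i))\<^sup>2)"
    by (auto simp: s_def)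
  define u where "u i = v $ i / of_real s" for i
  have "(\<Sum>i<n. u i * cnj (u i)) = of_real ((\<Sum>i<n. (cmod (v $ i))\<^sup>2) / s\<^sup>2)"
    by (simp add: u_def complex_norm_square sum_divide_distrib power2_eq_square[of s] del: of_real_power)
  also have "\<dots> = 1" using s(1) by (simp flip: s(2))
  finally have "(\<Sum>i<n. u i * cnj (u i)) = 1" .
  moreover have "(\<Sum>i<n. u i * c b i) = 0" if "b < n" "b \<noteq> a" for b
    using orth[OF that] by (simp add: u_def sum_divide_distrib[symmetric])
  ultimately show ?thesis by blast
qed

text \<open>
  The rows of \<open>h\<close> are chosen in order of increasing weight; the row \<open>a\<close> has to satisfy one linear condition for each
  \<open>b \<noteq> a\<close>, orthogonality to the row \<open>b\<close> or to the column \<open>b\<close> of \<open>g\<close>.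
\<close>

lemma exists_triangularizing_unitary:
  fixes g :: "nat \<Rightarrow> nat \<Rightarrow> complex" and l :: "nat \<Rightarrow> real"
  shows "\<exists>h. orthonormal_rows n h \<and>
    (\<forall>a<n. \<forall>b<n. l a < l b \<longrightarrow> (\<Sum>i<n. h a i * g i b) = 0)"
proof -
  have "S \<subseteq> {..<n} \<Longrightarrow> \<exists>h. (\<forall>a\<in>S. \<forall>b\<in>S. (\<Sum>i<n. h a i * cnj (h b i)) = (if a = b then 1 else 0)) \<and>
    (\<forall>a\<in>S. \<forall>b<n. l a < l b \<longrightarrow> (\<Sum>i<n. h a i * g i b) = 0)" if "finite S" for S
    using that
  proof (induction rule: finite_ranking_induct[where f = l])
    case empty
    then show ?case by simp
  next
    case (insert a S)
    from insert obtain h where h: 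
      "\<And>x y. x \<in> S \<Longrightarrow> y \<in> S \<Longrightarrow> (\<Sum>i<n. h x i * cnj (h y i)) = (if x = y then 1 else 0)"
      "\<And>x b. x \<in> S \<Longrightarrow> b < n \<Longrightarrow> l x < l b \<Longrightarrow> (\<Sum>i<n. h x i * g i b) = 0"
      by (metis insert_subset)
    have a: "a < n" using insert by simp
    show ?case
    \<comment> \<open>The induction rule allows the new element to lie in \<open>S\<close>
      already.\<close>
    proof (cases "a \<in> S")
      case True
      then show ?thesis using h by (intro exI[of _ h]) (auto simp: insert_absorb)
    next
      case False
      obtain u where u: "(\<Sum>i<n. u i * cnj (u i)) = 1"
        "\<And>b. b < n \<Longrightarrow> b \<noteq> a \<Longrightarrow> (\<Sum>i<n. u i * (if b \<in> S then cnj (h b i) else g i b)) = 0"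
        using exists_unit_vector_orthogonal[OF a, of "\<lambda>b i. if b \<in> S then cnj (h b i) else g i b"] by blast
      have uS: "(\<Sum>i<n. u i * cnj (h b i)) = 0" if "b \<in> S" for b
        using u(2)[of b] that insert.prems False by auto
      have uS': "(\<Sum>i<n. h b i * cnj (u i)) = 0" if "b \<in> S" for b
      proof -
        have "(\<Sum>i<n. h b i * cnj (u i)) = cnj (\<Sum>i<n. u i * cnj (h b i))"
          by (simp add: mult.commute)
        then show ?thesis using uS[OF that] by simp
      qed
      \<comment> \<open>All of \<open>S\<close> is at most as heavy as \<open>a\<close>, so a
        heavier \<open>b\<close> lies outside \<open>S\<close> and its condition is the one on the
        column of \<open>g\<close>.\<close>
      have ug: "(\<Sum>i<n. u i * g i b) = 0" if "b < n" "l a < l b" for b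
      proof -
        have "b \<notin> S" "b \<noteq> a" using insert.hyps(2) that by force+
        then show ?thesis using u(2)[of b] that by simp
      qed
      show ?thesis
        using h u(1) uS uS' ug False by (intro exI[of _ "h(a := u)"]) auto
    qed
  qed
  from this[of "{..<n}"] obtain h where
    "\<forall>a\<in>{..<n}. \<forall>b\<in>{..<n}. (\<Sum>i<n. h a i * cnj (h b i)) = (if a = b then 1 else 0)"
    "\<forall>a\<in>{..<n}. \<forall>b<n. l a < l b \<longrightarrow> (\<Sum>i<n. h a i * g i b) = 0"
    by blast
  then show ?thesis
    unfolding orthonormal_rows_def by (intro exI[of _ h]) simp
qed

subsection \<open>Marginals along an orbit\<close>

definition agree_off :: "nat \<Rightarrow> nat \<Rightarrow> nat list \<Rightarrow> nat list \<Rightarrow> bool" where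
  "agree_off d k x y \<longleftrightarrow> (\<forall>l<d. l \<noteq> k \<longrightarrow> x ! l = y ! l)"

text \<open>The \<open>k\<close>-th marginal without normalisation.\<close>

definition reduced_form ::
    "nat \<Rightarrow> nat \<Rightarrow> nat \<Rightarrow> (nat list \<Rightarrow> complex) \<Rightarrow> nat \<Rightarrow> nat \<Rightarrow> complex" where
  "reduced_form n d k w a b = (\<Sum>x\<in>multi_indices n d. \<Sum>y\<in>multi_indices n d.
     if x ! k = a \<and> y ! k = b \<and> agree_off d k x y then w x * cnj (w y) else 0)"

definition sq_norm :: "nat \<Rightarrow> nat \<Rightarrow> (nat list \<Rightarrow> complex) \<Rightarrow> real" where
  "sq_norm n d w = (\<Sum>x\<in>multi_indices n d. (cmod (w x))\<^sup>2)"

lemma agree_off_eq_iff: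
  assumes "x \<in> multi_indices n d" "y \<in> multi_indices n d" "k < d" "x ! k = y ! k"
  shows "agree_off d k x y \<longleftrightarrow> x = y"
proof
  assume "agree_off d k x y"
  then show "x = y"
    using assms by (intro nth_equalityI) (auto simp: agree_off_def multi_indices_def)
qed (simp add: agree_off_def)

lemma reduced_form_diag:
  assumes k: "k < d"
  shows "reduced_form n d k w a a
    = of_real (\<Sum>x | x \<in> multi_indices n d \<and> x ! k = a. (cmod (w x))\<^sup>2)"
proof -
  have "reduced_form n d k w a a = (\<Sum>x\<in>multi_indices n d. \<Sum>y\<in>multi_indices n d.
     if x = y then (if x ! k = a then w x * cnj (w x) else 0) else 0)"
    unfolding reduced_form_def
  proof (intro sum.cong refl)
    fix x y assume "x \<in> multi_indices n d" "y \<in> multi_indices n d"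
    then show "(if x ! k = a \<and> y ! k = a \<and> agree_off d k x y then w x * cnj (w y) else 0)
      = (if x = y then (if x ! k = a then w x * cnj (w x) else 0) else 0)"
      using agree_off_eq_iff[of x n d y k] k by auto
  qed
  also have "\<dots> = (\<Sum>x\<in>multi_indices n d. if x ! k = a then of_real ((cmod (w x))\<^sup>2) else 0)"
    by (intro sum.cong refl) (simp add: finite_multi_indices complex_norm_square del: of_real_power)
  finally show ?thesis
    unfolding of_real_sum by (subst sum.inter_filter) (simp_all add: finite_multi_indices)
qed

lemma sum_partition_by_letter:
  fixes f :: "nat list \<Rightarrow> 'a::comm_monoid_add"
  assumes k: "k < d"
  shows "(\<Sum>a<n. \<Sum>x | x \<in> multi_indices n d \<and> x ! k = a. f x) = (\<Sum>x\<in>multi_indices n d. f x)"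
proof (rule sum.group)
  show "(\<lambda>x. x ! k) ` multi_indices n d \<subseteq> {..<n}"
    using multi_indices_nth_less[OF _ k] by auto
qed (simp_all add: finite_multi_indices)

text \<open>The unitaries on the legs other than \<open>k\<close> cancel in the sum of squared
  moduli. What remains is the diagonal entry \<open>(i, i)\<close> of the \<open>k\<close>-th
  unnormalised marginal conjugated by \<open>h k\<close>.\<close>

lemma sum_unitary_image_eq:
  fixes h :: "nat \<Rightarrow> nat \<Rightarrow> nat \<Rightarrow> complex" and w :: "nat list \<Rightarrow> complex"
  assumes h: "\<And>l. l < d \<Longrightarrow> orthonormal_rows n (h l)" and k: "k < d" and i: "i < n"
  defines "u \<equiv> \<lambda>x. \<Sum>y\<in>multi_indices n d. (\<Prod>l<d. h l (x ! l) (y ! l)) * w y"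
  shows "of_real (\<Sum>x | x \<in> multi_indices n d \<and> x ! k = i. (cmod (u x))\<^sup>2)
    = (\<Sum>a<n. \<Sum>b<n. h k i a * cnj (h k i b) * reduced_form n d k w a b)"
proof -
  let ?M = "multi_indices n d"
  have prod_eq: "(\<Sum>x\<in>?M. if x ! k = i then
        (\<Prod>l<d. h l (x ! l) (y ! l)) * cnj (\<Prod>l<d. h l (x ! l) (z ! l)) else 0)
      = (if agree_off d k y z then h k i (y ! k) * cnj (h k i (z ! k)) else 0)"
    if y: "y \<in> ?M" and z: "z \<in> ?M" for y z
  proof -
    \<comment> \<open>Moving the condition \<open>x ! k = i\<close> into the factor of leg
      \<open>k\<close> keeps the summand a product over the legs, so that the sum
      factorises.\<close>
    define f where "f l a = (if l = k \<and> a \<noteq> i then 0 else h l a (y ! l) * cnj (h l a (z ! l)))" for l a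
    have "(\<Sum>x\<in>?M. if x ! k = i then
        (\<Prod>l<d. h l (x ! l) (y ! l)) * cnj (\<Prod>l<d. h l (x ! l) (z ! l)) else 0)
      = (\<Sum>x\<in>?M. \<Prod>l<d. f l (x ! l))"
    proof (intro sum.cong refl)
      fix x
      show "(if x ! k = i then (\<Prod>l<d. h l (x ! l) (y ! l)) * cnj (\<Prod>l<d. h l (x ! l) (z ! l)) else 0)
        = (\<Prod>l<d. f l (x ! l))"
      proof (cases "x ! k = i")
        case True
        then have "(\<Prod>l<d. f l (x ! l)) = (\<Prod>l<d. h l (x ! l) (y ! l) * cnj (h l (x ! l) (z ! l)))"
          by (intro prod.cong) (auto simp: f_def)
        then show ?thesis using True
          by (simp add: prod.distrib)
      next
        case False
        then have "f k (x ! k) = 0" by (simp add: f_def)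
        then have "(\<Prod>l<d. f l (x ! l)) = 0"
          using k by (intro prod_zero) auto
        then show ?thesis using False by simp
      qed
    qed
    also have "\<dots> = (\<Prod>l<d. \<Sum>a<n. f l a)"
      by (rule sum_multi_indices_prod)
    also have "\<dots> = (\<Prod>l<d. if l = k then h k i (y ! k) * cnj (h k i (z ! k))
        else if y ! l = z ! l then 1 else 0)"
    proof (intro prod.cong refl)
      fix l assume "l \<in> {..<d}"
      then have l: "l < d" by simp
      show "(\<Sum>a<n. f l a) = (if l = k then h k i (y ! k) * cnj (h k i (z ! k))
        else if y ! l = z ! l then 1 else 0)"
      proof (cases "l = k")
        case True
        have "(\<Sum>a<n. f l a) = (\<Sum>a<n. if a = i then h k i (y ! k) * cnj (h k i (z ! k)) else 0)"
          using True by (intro sum.cong) (auto simp: f_def)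
        then show ?thesis using True i by simp
      next
        case False
        then show ?thesis
          using orthonormal_rows_columns[OF h[OF l], of "y ! l" "z ! l"]
            multi_indices_nth_less[OF y l] multi_indices_nth_less[OF z l] by (simp add: f_def)
      qed
    qed
    also have "\<dots> = h k i (y ! k) * cnj (h k i (z ! k)) *
        (\<Prod>l\<in>{..<d} - {k}. if y ! l = z ! l then 1 else 0)"
      using k by (subst prod.remove[of _ k]) auto
    also have "(\<Prod>l\<in>{..<d} - {k}. if y ! l = z ! l then 1 else 0)
        = (if agree_off d k y z then 1 else (0::complex))"
      by (auto simp: agree_off_def)
    finally show ?thesis by simp
  qed
  have "of_real (\<Sum>x | x \<in> ?M \<and> x ! k = i. (cmod (u x))\<^sup>2)
      = (\<Sum>x\<in>?M. if x ! k = i then u x * cnj (u x) else 0)"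
    unfolding of_real_sum
    by (subst sum.inter_filter) (auto simp: finite_multi_indices complex_norm_square
      simp del: of_real_power intro!: sum.cong)
  also have "\<dots> = (\<Sum>x\<in>?M. \<Sum>y\<in>?M. \<Sum>z\<in>?M. w y * cnj (w z) * (if x ! k = i then
        (\<Prod>l<d. h l (x ! l) (y ! l)) * cnj (\<Prod>l<d. h l (x ! l) (z ! l)) else 0))"
    by (intro sum.cong refl) (simp add: u_def sum_product mult_ac)
  also have "\<dots> = (\<Sum>y\<in>?M. \<Sum>x\<in>?M. \<Sum>z\<in>?M. w y * cnj (w z) * (if x ! k = i then
        (\<Prod>l<d. h l (x ! l) (y ! l)) * cnj (\<Prod>l<d. h l (x ! l) (z ! l)) else 0))"
    by (rule sum.swap)
  also have "\<dots> = (\<Sum>y\<in>?M. \<Sum>z\<in>?M. w y * cnj (w z) * (\<Sum>x\<in>?M. if x ! k = i then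
        (\<Prod>l<d. h l (x ! l) (y ! l)) * cnj (\<Prod>l<d. h l (x ! l) (z ! l)) else 0))"
    unfolding sum_distrib_left by (intro sum.cong refl sum.swap)
  also have "\<dots> = (\<Sum>y\<in>?M. \<Sum>z\<in>?M. w y * cnj (w z) *
      (if agree_off d k y z then h k i (y ! k) * cnj (h k i (z ! k)) else 0))"
    by (intro sum.cong refl) (simp only: prod_eq)
  also have "\<dots> = (\<Sum>y\<in>?M. \<Sum>z\<in>?M. \<Sum>a<n. \<Sum>b<n. h k i a * cnj (h k i b) *
      (if y ! k = a \<and> z ! k = b \<and> agree_off d k y z then w y * cnj (w z) else 0))"
  proof (intro sum.cong refl)
    fix y z assume y: "y \<in> ?M" and z: "z \<in> ?M"
    have "(\<Sum>a<n. \<Sum>b<n. h k i a * cnj (h k i b) *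
        (if y ! k = a \<and> z ! k = b \<and> agree_off d k y z then w y * cnj (w z) else 0))
      = (\<Sum>a<n. \<Sum>b<n. if b = z ! k then if a = y ! k then h k i a * cnj (h k i b) *
        (if agree_off d k y z then w y * cnj (w z) else 0) else 0 else 0)"
      by (intro sum.cong refl) auto
    also have "\<dots> = w y * cnj (w z) * (if agree_off d k y z then h k i (y ! k) * cnj (h k i (z ! k)) else 0)"
      using multi_indices_nth_less[OF y k] multi_indices_nth_less[OF z k] by simp
    finally show "w y * cnj (w z) * (if agree_off d k y z then h k i (y ! k) * cnj (h k i (z ! k)) else 0)
      = (\<Sum>a<n. \<Sum>b<n. h k i a * cnj (h k i b) *
        (if y ! k = a \<and> z ! k = b \<and> agree_off d k y z then w y * cnj (w z) else 0))"
      by (rule sym)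
  qed
  also have "\<dots> = (\<Sum>a<n. \<Sum>b<n. \<Sum>y\<in>?M. \<Sum>z\<in>?M. h k i a * cnj (h k i b) *
      (if y ! k = a \<and> z ! k = b \<and> agree_off d k y z then w y * cnj (w z) else 0))"
    by (simp only: sum.swap[of _ "{..<n}" ?M])
  finally show ?thesis
    by (simp add: reduced_form_def sum_distrib_left)
qed

text \<open>The triangularised matrices move the support only to letters of no smaller weight, so
  the rotated tensor \<open>u\<close> still pairs with \<open>lam\<close> to at least
  \<open>c\<close> times its squared norm. Uniform marginals pair to 0, so the deviation from
  uniformity has to account for this. Both sides are continuous in \<open>w\<close>, which later
  carries the bound to the orbit closure.\<close>

lemma orbit_marginals_lower_bound:
  fixes lam :: "nat \<Rightarrow> nat \<Rightarrow> real" and g v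
  assumes n: "n > 0" and d: "d > 0"
    and lam0: "\<And>k. k < d \<Longrightarrow> (\<Sum>a<n. lam k a) = 0"
    and supp: "\<And>x. x \<in> multi_indices n d \<Longrightarrow> v x \<noteq> 0 \<Longrightarrow> c \<le> (\<Sum>k<d. lam k (x ! k))"
  defines "w \<equiv> tensor_action n d g v"
  shows "c * sq_norm n d w \<le> (\<Sum>k<d. (\<Sum>i<n. \<bar>lam k i\<bar>) *
    (\<Sum>a<n. \<Sum>b<n. cmod (reduced_form n d k w a b - (if a = b then of_real (sq_norm n d w / n) else 0))))"
proof -
  let ?M = "multi_indices n d"
  let ?N = "sq_norm n d w"
  have "\<exists>h. \<forall>k. orthonormal_rows n (h k) \<and>
    (\<forall>a<n. \<forall>b<n. lam k a < lam k b \<longrightarrow> (\<Sum>i<n. h k a i * g k $$ (i, b)) = 0)"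
    by (intro choice allI exists_triangularizing_unitary)
  then obtain h where h: "\<And>k. orthonormal_rows n (h k)"
    and tri: "\<And>k a b. a < n \<Longrightarrow> b < n \<Longrightarrow> lam k a < lam k b \<Longrightarrow> (\<Sum>i<n. h k a i * g k $$ (i, b)) = 0"
    by blast
  define u where "u = (\<lambda>x. \<Sum>y\<in>?M. (\<Prod>l<d. h l (x ! l) (y ! l)) * w y)"
  have u_eq: "u x = (\<Sum>z\<in>?M. (\<Prod>l<d. \<Sum>i<n. h l (x ! l) i * g l $$ (i, z ! l)) * v z)" for x
  proof -
    have "u x = (\<Sum>y\<in>?M. \<Sum>z\<in>?M. (\<Prod>l<d. h l (x ! l) (y ! l) * g l $$ (y ! l, z ! l)) * v z)"
      unfolding u_def w_def tensor_action_def
      by (intro sum.cong refl) (simp add: sum_distrib_left prod.distrib mult.assoc)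
    also have "\<dots> = (\<Sum>z\<in>?M. (\<Sum>y\<in>?M. \<Prod>l<d. h l (x ! l) (y ! l) * g l $$ (y ! l, z ! l)) * v z)"
      by (subst sum.swap) (simp add: sum_distrib_right)
    also have "\<dots> = (\<Sum>z\<in>?M. (\<Prod>l<d. \<Sum>i<n. h l (x ! l) i * g l $$ (i, z ! l)) * v z)"
    proof (intro sum.cong refl arg_cong2[of _ _ _ _ "(*)"])
      fix z
      show "(\<Sum>y\<in>?M. \<Prod>l<d. h l (x ! l) (y ! l) * g l $$ (y ! l, z ! l))
        = (\<Prod>l<d. \<Sum>i<n. h l (x ! l) i * g l $$ (i, z ! l))"
        by (rule sum_multi_indices_prod[of "\<lambda>l i. h l (x ! l) i * g l $$ (i, z ! l)"])
    qed
    finally show ?thesis .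
  qed
  have u_supp: "c \<le> (\<Sum>k<d. lam k (x ! k))" if x: "x \<in> ?M" and "u x \<noteq> 0" for x
  proof -
    obtain z where z: "z \<in> ?M" "(\<Prod>l<d. \<Sum>i<n. h l (x ! l) i * g l $$ (i, z ! l)) * v z \<noteq> 0"
      using \<open>u x \<noteq> 0\<close> unfolding u_eq by (meson sum.neutral)
    have "lam l (z ! l) \<le> lam l (x ! l)" if "l < d" for l
    proof (rule ccontr)
      assume "\<not> ?thesis"
      then have "(\<Sum>i<n. h l (x ! l) i * g l $$ (i, z ! l)) = 0"
        using tri multi_indices_nth_less x z(1) that by simp
      then have "(\<Prod>l<d. \<Sum>i<n. h l (x ! l) i * g l $$ (i, z ! l)) = 0"
        using that by (intro prod_zero) auto
      then show False using z(2) by simp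
    qed
    then have "(\<Sum>k<d. lam k (z ! k)) \<le> (\<Sum>k<d. lam k (x ! k))"
      by (intro sum_mono) simp
    then show ?thesis
      using supp[OF z(1)] z(2) by fastforce
  qed
  \<comment> \<open>\<open>S k\<close> is the diagonal of the rotated marginal and
    \<open>E k\<close> the deviation before the rotation; conjugation by a unitary fixes the uniform
    part.\<close>
  define S where "S k i = (\<Sum>x | x \<in> ?M \<and> x ! k = i. (cmod (u x))\<^sup>2)" for k i
  define E where "E k a b = reduced_form n d k w a b - (if a = b then of_real (?N / n) else 0)" for k a b
  have S_eq: "of_real (S k i) = (\<Sum>a<n. \<Sum>b<n. h k i a * cnj (h k i b) * reduced_form n d k w a b)"
    if "k < d" "i < n" for k i
    unfolding S_def u_def by (rule sum_unitary_image_eq) (use h that in auto)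
  have norm_u: "(\<Sum>x\<in>?M. (cmod (u x))\<^sup>2) = ?N"
  proof -
    have "complex_of_real (\<Sum>x\<in>?M. (cmod (u x))\<^sup>2) = (\<Sum>i<n. of_real (S 0 i))"
      unfolding S_def sum_partition_by_letter[OF d, symmetric] by simp
    also have "\<dots> = (\<Sum>i<n. \<Sum>a<n. \<Sum>b<n. h 0 i a * cnj (h 0 i b) * reduced_form n d 0 w a b)"
      using S_eq d by (intro sum.cong) auto
    also have "\<dots> = (\<Sum>a<n. \<Sum>i<n. \<Sum>b<n. h 0 i a * cnj (h 0 i b) * reduced_form n d 0 w a b)"
      by (rule sum.swap)
    also have "\<dots> = (\<Sum>a<n. \<Sum>b<n. (\<Sum>i<n. h 0 i a * cnj (h 0 i b)) * reduced_form n d 0 w a b)"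
      unfolding sum_distrib_right by (intro sum.cong refl sum.swap)
    also have "\<dots> = (\<Sum>a<n. \<Sum>b<n. (if a = b then 1 else 0) * reduced_form n d 0 w a b)"
      by (intro sum.cong refl arg_cong2[of _ _ _ _ "(*)"] orthonormal_rows_columns[OF h]) auto
    also have "\<dots> = (\<Sum>a<n. reduced_form n d 0 w a a)"
      by (intro sum.cong refl) (simp add: if_distrib[of "\<lambda>t. t * _"] cong: if_cong)
    also have "\<dots> = of_real ?N"
      unfolding reduced_form_diag[OF d] sq_norm_def sum_partition_by_letter[OF d, symmetric] by simp
    finally show ?thesis
      using of_real_eq_iff by blast
  qed
  have S_split: "of_real (S k i) = of_real (?N / n) + (\<Sum>a<n. \<Sum>b<n. h k i a * cnj (h k i b) * E k a b)"
    if k: "k < d" and i: "i < n" for k i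
  proof -
    have "of_real (S k i) = (\<Sum>a<n. \<Sum>b<n. h k i a * cnj (h k i b) * (if a = b then of_real (?N / n) else 0)
        + h k i a * cnj (h k i b) * E k a b)"
      unfolding S_eq[OF that] E_def by (simp add: algebra_simps)
    also have "\<dots> = (\<Sum>a<n. \<Sum>b<n. if a = b then h k i a * cnj (h k i b) * of_real (?N / n) else 0)
        + (\<Sum>a<n. \<Sum>b<n. h k i a * cnj (h k i b) * E k a b)"
      unfolding sum.distrib by (intro arg_cong2[of _ _ _ _ "(+)"] sum.cong refl) auto
    also have "(\<Sum>a<n. \<Sum>b<n. if a = b then h k i a * cnj (h k i b) * of_real (?N / n) else 0)
        = (\<Sum>a<n. h k i a * cnj (h k i a)) * of_real (?N / n)"
      unfolding sum_distrib_right by (intro sum.cong refl) simp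
    also have "\<dots> = of_real (?N / n)"
      using h[of k] i by (simp add: orthonormal_rows_def)
    finally show ?thesis .
  qed
  have S_bound: "\<bar>S k i - ?N / n\<bar> \<le> (\<Sum>a<n. \<Sum>b<n. cmod (E k a b))" if k: "k < d" and i: "i < n" for k i
  proof -
    \<comment> \<open>Entries of a unit row have modulus at most 1, so the rotated deviation is at
      most the sum of the moduli of all entries of \<open>E k\<close>.\<close>
    have h1: "cmod (h k i a) \<le> 1" if "a < n" for a
    proof -
      have "complex_of_real (\<Sum>j<n. (cmod (h k i j))\<^sup>2) = of_real 1"
        using h[of k] i by (simp add: orthonormal_rows_def complex_norm_square del: of_real_power)
      then have "(\<Sum>j<n. (cmod (h k i j))\<^sup>2) = 1"
        using of_real_eq_iff by blast
      then have "(cmod (h k i a))\<^sup>2 \<le> 1"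
        using member_le_sum[of a "{..<n}" "\<lambda>j. (cmod (h k i j))\<^sup>2"] that by simp
      then show ?thesis
        by (simp add: power_le_one_iff abs_square_le_1)
    qed
    have "\<bar>S k i - ?N / n\<bar> = cmod (of_real (S k i) - of_real (?N / n))"
      by (metis norm_of_real of_real_diff)
    also have "\<dots> = cmod (\<Sum>a<n. \<Sum>b<n. h k i a * cnj (h k i b) * E k a b)"
      by (simp add: S_split[OF that])
    also have "\<dots> \<le> (\<Sum>a<n. \<Sum>b<n. cmod (h k i a * cnj (h k i b) * E k a b))"
      by (intro order.trans[OF norm_sum] sum_mono norm_sum)
    also have "\<dots> \<le> (\<Sum>a<n. \<Sum>b<n. cmod (E k a b))"
    proof (intro sum_mono)
      fix a b assume "a \<in> {..<n}" "b \<in> {..<n}"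
      then have "cmod (h k i a) * cmod (h k i b) \<le> 1 * 1"
        by (intro mult_mono h1) auto
      then show "cmod (h k i a * cnj (h k i b) * E k a b) \<le> cmod (E k a b)"
        by (simp add: norm_mult mult_left_le_one_le)
    qed
    finally show ?thesis .
  qed
  have "c * ?N = (\<Sum>x\<in>?M. c * (cmod (u x))\<^sup>2)"
    by (simp add: norm_u[symmetric] sum_distrib_left)
  also have "\<dots> \<le> (\<Sum>x\<in>?M. (\<Sum>k<d. lam k (x ! k)) * (cmod (u x))\<^sup>2)"
  proof (rule sum_mono)
    fix x assume "x \<in> ?M"
    then show "c * (cmod (u x))\<^sup>2 \<le> (\<Sum>k<d. lam k (x ! k)) * (cmod (u x))\<^sup>2"
      using u_supp[of x] by (cases "u x = 0") (auto intro: mult_right_mono)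
  qed
  also have "\<dots> = (\<Sum>k<d. \<Sum>x\<in>?M. lam k (x ! k) * (cmod (u x))\<^sup>2)"
    unfolding sum_distrib_right by (rule sum.swap)
  also have "\<dots> = (\<Sum>k<d. \<Sum>i<n. lam k i * S k i)"
  proof (rule sum.cong[OF refl])
    fix k assume "k \<in> {..<d}"
    then have k: "k < d" by simp
    show "(\<Sum>x\<in>?M. lam k (x ! k) * (cmod (u x))\<^sup>2) = (\<Sum>i<n. lam k i * S k i)"
      unfolding S_def sum_distrib_left sum_partition_by_letter[OF k, symmetric]
      by (intro sum.cong refl) auto
  qed
  \<comment> \<open>The constant can be subtracted because the weights of each leg sum to 0.\<close>
  also have "\<dots> = (\<Sum>k<d. \<Sum>i<n. lam k i * (S k i - ?N / n))"
  proof (rule sum.cong[OF refl])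
    fix k assume "k \<in> {..<d}"
    then have "(\<Sum>i<n. lam k i * (?N / n)) = 0"
      unfolding sum_distrib_right[symmetric] using lam0[of k] by simp
    then show "(\<Sum>i<n. lam k i * S k i) = (\<Sum>i<n. lam k i * (S k i - ?N / n))"
      by (simp add: right_diff_distrib sum_subtractf)
  qed
  also have "\<dots> \<le> (\<Sum>k<d. \<Sum>i<n. \<bar>lam k i\<bar> * (\<Sum>a<n. \<Sum>b<n. cmod (E k a b)))"
  proof (intro sum_mono)
    fix k i assume "k \<in> {..<d}" "i \<in> {..<n}"
    then have "\<bar>lam k i * (S k i - ?N / n)\<bar> \<le> \<bar>lam k i\<bar> * (\<Sum>a<n. \<Sum>b<n. cmod (E k a b))"
      unfolding abs_mult by (intro mult_left_mono S_bound) auto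
    then show "lam k i * (S k i - ?N / n) \<le> \<bar>lam k i\<bar> * (\<Sum>a<n. \<Sum>b<n. cmod (E k a b))"
      by linarith
  qed
  finally show ?thesis
    by (simp add: E_def sum_distrib_right)
qed

subsection \<open>Spectra of marginals\<close>

lemma mat_adjoint_index:
  fixes A :: "complex mat"
  assumes "i < dim_col A" "j < dim_row A"
  shows "mat_adjoint A $$ (i, j) = cnj (A $$ (j, i))"
  using assms unfolding mat_adjoint_def by (simp add: mat_of_rows_index)

lemma mat_adjoint_dim: "dim_row (mat_adjoint A) = dim_col A" "dim_col (mat_adjoint A) = dim_row A"
  unfolding mat_adjoint_def by simp_all

lemma tensor_norm_sq: "(tensor_norm n d w)\<^sup>2 = sq_norm n d w"
  unfolding tensor_norm_def sq_norm_def by (intro real_sqrt_pow2 sum_nonneg zero_le_power2)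

text \<open>The enumeration is the one by which \<open>flattening\<close> orders its
  columns.\<close>

lemma sum_multi_indices_eq_sum_nth:
  "(\<Sum>c\<in>multi_indices n m. F c) = (\<Sum>j<n ^ m. F (List.n_lists m [0..<n] ! j))"
proof -
  let ?L = "List.n_lists m [0..<n]"
  have "set ?L = multi_indices n m"
    by (auto simp: set_n_lists multi_indices_def)
  moreover have "distinct ?L"
    by (rule distinct_n_lists) simp
  ultimately have "bij_betw ((!) ?L) {..<length ?L} (multi_indices n m)"
    by (metis bij_betw_nth)
  then show ?thesis
    by (simp add: sum.reindex_bij_betw[symmetric] length_n_lists)
qed

lemma multi_indices_insert:
  assumes "k < d" "a < n" "c \<in> multi_indices n (d - 1)"
  shows "take k c @ a # drop k c \<in> multi_indices n d"
proof -
  have "set (take k c @ a # drop k c) = insert a (set (take k c @ drop k c))"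
    unfolding set_append by auto
  also have "\<dots> = insert a (set c)"
    by (simp only: append_take_drop_id)
  finally show ?thesis
    using assms by (auto simp: multi_indices_def simp del: set_append)
qed

lemma multi_indices_delete:
  assumes "k < d" "x \<in> multi_indices n d"
  shows "take k x @ drop (Suc k) x \<in> multi_indices n (d - 1)"
proof -
  have "set (take k x @ drop (Suc k) x) \<subseteq> set x"
    using set_take_subset[of k x] set_drop_subset[of "Suc k" x] by simp
  then show ?thesis
    using assms by (auto simp: multi_indices_def simp del: set_append)
qed

text \<open>A pair agreeing off leg \<open>k\<close> corresponds to its common remainder after leg
  \<open>k\<close> is deleted, that is, to a column of the flattening.\<close>

lemma reduced_form_eq_sum_insert:
  assumes k: "k < d" and a: "a < n" and b: "b < n"
  shows "reduced_form n d k w a b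
    = (\<Sum>c\<in>multi_indices n (d - 1). w (take k c @ a # drop k c) * cnj (w (take k c @ b # drop k c)))"
proof -
  let ?M = "multi_indices n d"
  let ?P = "{(x, y). x \<in> ?M \<and> y \<in> ?M \<and> x ! k = a \<and> y ! k = b \<and> agree_off d k x y}"
  have ins: "take k (take k x @ drop (Suc k) x) @ (x ! k) # drop k (take k x @ drop (Suc k) x) = x"
    if "x \<in> ?M" for x
    using that k by (simp add: multi_indices_def min_def id_take_nth_drop[symmetric])
  have "reduced_form n d k w a b = (\<Sum>p\<in>?M \<times> ?M. if p \<in> ?P then w (fst p) * cnj (w (snd p)) else 0)"
    unfolding reduced_form_def sum.cartesian_product by (intro sum.cong refl) force
  also have "\<dots> = (\<Sum>p\<in>?P. w (fst p) * cnj (w (snd p)))"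
  proof -
    have "?M \<times> ?M \<inter> {p. p \<in> ?P} = ?P" by auto
    then show ?thesis
      by (subst sum.If_cases) (simp_all add: finite_multi_indices)
  qed
  also have "\<dots> = (\<Sum>c\<in>multi_indices n (d - 1). w (take k c @ a # drop k c) * cnj (w (take k c @ b # drop k c)))"
  proof (rule sum.reindex_bij_witness[where
        j = "\<lambda>p. take k (fst p) @ drop (Suc k) (fst p)" and
        i = "\<lambda>c. (take k c @ a # drop k c, take k c @ b # drop k c)"])
    fix p assume "p \<in> ?P"
    then obtain x y where p: "p = (x, y)" and x: "x \<in> ?M" and y: "y \<in> ?M"
      and xy: "x ! k = a" "y ! k = b" "agree_off d k x y"
      by auto
    have "take k x = take k y" "drop (Suc k) x = drop (Suc k) y"
      using x y k xy(3) by (auto simp: multi_indices_def agree_off_def intro!: nth_equalityI)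
    then show "(take k (take k (fst p) @ drop (Suc k) (fst p)) @ a # drop k (take k (fst p) @ drop (Suc k) (fst p)),
      take k (take k (fst p) @ drop (Suc k) (fst p)) @ b # drop k (take k (fst p) @ drop (Suc k) (fst p))) = p"
      and "w (take k (take k (fst p) @ drop (Suc k) (fst p)) @ a # drop k (take k (fst p) @ drop (Suc k) (fst p))) *
        cnj (w (take k (take k (fst p) @ drop (Suc k) (fst p)) @ b # drop k (take k (fst p) @ drop (Suc k) (fst p))))
        = w (fst p) * cnj (w (snd p))"
      using ins[OF x] ins[OF y] xy p by simp_all
    show "take k (fst p) @ drop (Suc k) (fst p) \<in> multi_indices n (d - 1)"
      using multi_indices_delete[OF k x] p by simp
  next
    fix c assume c: "c \<in> multi_indices n (d - 1)"
    then have len: "length c = d - 1" by (simp add: multi_indices_def)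
    show "take k (fst (take k c @ a # drop k c, take k c @ b # drop k c)) @
        drop (Suc k) (fst (take k c @ a # drop k c, take k c @ b # drop k c)) = c"
      using len k by (simp add: min_def)
    show "(take k c @ a # drop k c, take k c @ b # drop k c) \<in> ?P"
      using multi_indices_insert[OF k a c] multi_indices_insert[OF k b c] len k
      by (auto simp: agree_off_def nth_append min_def nth_Cons')
  qed
  finally show ?thesis .
qed

lemma marginal_carrier: "marginal n d k w \<in> carrier_mat n n"
  unfolding marginal_def flattening_def Let_def by (intro carrier_matI) (simp_all add: mat_adjoint_dim)

lemma marginal_index:
  assumes k: "k < d" and a: "a < n" and b: "b < n"
  shows "marginal n d k w $$ (a, b) = reduced_form n d k w a b / of_real (sq_norm n d w)"
proof -
  let ?s = "complex_of_real (tensor_norm n d w)"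
  define M where "M = flattening n d k (\<lambda>x. w x / ?s)"
  have dim: "dim_row M = n" "dim_col M = n ^ (d - 1)"
    by (simp_all add: M_def flattening_def)
  have "marginal n d k w $$ (a, b) = (\<Sum>j<n ^ (d - 1). M $$ (a, j) * cnj (M $$ (b, j)))"
    unfolding marginal_def M_def[symmetric] Let_def
    using a b dim by (simp add: scalar_prod_def mat_adjoint_dim mat_adjoint_index lessThan_atLeast0)
  also have "\<dots> = (\<Sum>j<n ^ (d - 1). let c = List.n_lists (d - 1) [0..<n] ! j in
      w (take k c @ a # drop k c) * cnj (w (take k c @ b # drop k c)) / (?s * ?s))"
    using a b by (intro sum.cong refl) (simp add: M_def flattening_def Let_def)
  also have "\<dots> = reduced_form n d k w a b / (?s * ?s)"
    unfolding reduced_form_eq_sum_insert[OF assms] sum_multi_indices_eq_sum_nth sum_divide_distrib Let_def ..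
  also have "?s * ?s = of_real (sq_norm n d w)"
    unfolding tensor_norm_sq[symmetric] by (simp add: power2_eq_square)
  finally show ?thesis .
qed

lemma reduced_form_cnj: "cnj (reduced_form n d k w a b) = reduced_form n d k w b a"
proof -
  have "cnj (reduced_form n d k w a b) = (\<Sum>x\<in>multi_indices n d. \<Sum>y\<in>multi_indices n d.
     if y ! k = b \<and> x ! k = a \<and> agree_off d k y x then w y * cnj (w x) else 0)"
    unfolding reduced_form_def by (auto simp: agree_off_def intro!: sum.cong)
  then show ?thesis
    unfolding reduced_form_def by (subst (asm) sum.swap)
qed

lemma mset_spec: "mset (spec H) = image_mset Re (proots (char_poly H))"
  unfolding spec_def mset_rev mset_sorted_list_of_multiset ..

lemma mset_spec_factorized:
  assumes "char_poly H = (\<Prod>e\<leftarrow>es. [:- e, 1:])"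
  shows "mset (spec H) = mset (map Re es)"
proof -
  have "proots (\<Prod>e\<leftarrow>es. [:- e, 1:]) = mset es"
  proof (induction es)
    case (Cons e es)
    have "(\<Prod>e\<leftarrow>es. [:- e, 1:]) \<noteq> 0"
      by (auto simp: prod_list_zero_iff)
    then show ?case
      using Cons by (simp add: proots_mult del: mult_pCons_left)
  qed simp
  then show ?thesis
    by (simp add: mset_spec assms)
qed

text \<open>Symmetric sums do not see the sorting in \<open>spec\<close>, so they can be computed
  from any list of the eigenvalues.\<close>

lemma sum_spec_factorized:
  assumes "char_poly H = (\<Prod>e\<leftarrow>es. [:- e, 1:])"
  shows "(\<Sum>i<length es. f (spec H ! i)) = (\<Sum>e\<leftarrow>es. f (Re e))"
proof -
  note m = mset_spec_factorized[OF assms]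
  have "length (spec H) = length es"
    using mset_eq_length[OF m] by simp
  then have "(\<Sum>i<length es. f (spec H ! i)) = sum_list (map f (spec H))"
    by (simp add: sum_list_sum_nth lessThan_atLeast0)
  also have "\<dots> = sum_list (map f (map Re es))"
    by (metis m mset_map sum_mset_sum_list)
  finally show ?thesis by (simp add: comp_def)
qed

text \<open>
  The eigenvalues of \<open>H - t\<close> are purely imaginary, so the trace of its square is \<open>\<le> 0\<close>; as \<open>H\<close> is
  Hermitian, the same trace is the sum of the squared moduli of the entries.
\<close>

lemma hermitian_const_spec:
  assumes H: "H \<in> carrier_mat n n"
    and herm: "\<And>a b. a < n \<Longrightarrow> b < n \<Longrightarrow> H $$ (b, a) = cnj (H $$ (a, b))"
    and spec: "\<And>i. i < n \<Longrightarrow> spec H ! i = t"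
    and a: "a < n" and b: "b < n"
  shows "H $$ (a, b) = (if a = b then of_real t else 0)"
proof -
  obtain es where es: "char_poly H = (\<Prod>e\<leftarrow>es. [:- e, 1:])" "length es = n"
    using char_poly_factorized[OF H] by blast
  obtain B P Q where "schur_decomposition H es = (B, P, Q)"
    by (cases "schur_decomposition H es") auto
  then have sim: "similar_mat_wit H B P Q" and B: "upper_triangular B" and diag: "diag_mat B = es"
    using schur_decomposition[OF H es(1)] by auto
  note w = similar_mat_witD2[OF H sim]
  \<comment> \<open>\<open>spec\<close> records only real parts, so the eigenvalues are known up to
    an imaginary part.\<close>
  have Re_es: "Re e = t" if "e \<in> set es" for e
  proof -
    have m: "mset (spec H) = mset (map Re es)"
      by (rule mset_spec_factorized[OF es(1)])
    then have "Re e \<in> set (spec H)"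
      using that by (metis image_eqI list.set_map set_mset_mset)
    moreover have "length (spec H) = n"
      using mset_eq_length[OF m] es(2) by simp
    ultimately show ?thesis
      using spec by (metis in_set_conv_nth)
  qed
  let ?I = "of_real t \<cdot>\<^sub>m 1\<^sub>m n :: complex mat"
  define E where "E = H - ?I"
  define T where "T = B - ?I"
  have ET: "E \<in> carrier_mat n n" "T \<in> carrier_mat n n"
    using w by (auto simp: E_def T_def)
  have E_eq: "E = P * T * Q"
  proof -
    have "P * T * Q = P * B * Q - P * ?I * Q"
      unfolding T_def using w
      by (simp add: mult_minus_distrib_mat[of _ n n] minus_mult_distrib_mat[of _ n n])
    also have "P * ?I * Q = ?I"
      using w by (simp add: mult_smult_distrib[of _ n n _ n] mult_smult_assoc_mat[of _ n n _ n])
    finally show ?thesis using w by (simp add: E_def)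
  qed
  have E_herm: "E $$ (j, i) = cnj (E $$ (i, j))" if "i < n" "j < n" for i j
    using that herm[of i j] H by (simp add: E_def)
  define tr where "tr A = (\<Sum>i<n. A $$ (i, i))" for A :: "complex mat"
  have tr_comm: "tr (X * Y) = tr (Y * X)" if "X \<in> carrier_mat n n" "Y \<in> carrier_mat n n" for X Y
  proof -
    have "tr (X * Y) = (\<Sum>i<n. \<Sum>j<n. X $$ (i, j) * Y $$ (j, i))"
      using that by (simp add: tr_def scalar_prod_def lessThan_atLeast0)
    also have "\<dots> = (\<Sum>j<n. \<Sum>i<n. X $$ (i, j) * Y $$ (j, i))"
      by (rule sum.swap)
    finally show ?thesis
      using that by (simp add: tr_def scalar_prod_def lessThan_atLeast0 mult.commute)
  qed
  \<comment> \<open>The trace is cyclic, so \<open>E * E\<close> and \<open>T * T\<close> have the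
    same trace; \<open>T\<close> is triangular, so only the squares of its diagonal entries
    survive.\<close>
  have "E * E = P * T * (Q * P) * (T * Q)"
    unfolding E_eq using w(6,7) ET by (simp add: assoc_mult_mat[of _ n n _ n _ n])
  also have "\<dots> = P * (T * T * Q)"
    unfolding w(2) using w(6,7) ET by (simp add: assoc_mult_mat[of _ n n _ n _ n])
  finally have "tr (E * E) = tr (T * T * Q * P)"
    using w(6,7) ET by (simp add: tr_comm[of P])
  also have "T * T * Q * P = T * T"
    using w(6,7) ET by (simp add: assoc_mult_mat[of _ n n _ n _ n] w(2))
  also have "tr (T * T) = (\<Sum>i<n. (T $$ (i, i))\<^sup>2)"
    unfolding tr_def
  proof (intro sum.cong refl)
    fix i assume "i \<in> {..<n}"
    then have i: "i < n" by simp
    have "(T * T) $$ (i, i) = (\<Sum>j<n. T $$ (i, j) * T $$ (j, i))"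
      using ET i by (simp add: scalar_prod_def lessThan_atLeast0)
    also have "\<dots> = (\<Sum>j<n. if j = i then T $$ (i, i) * T $$ (i, i) else 0)"
    proof (intro sum.cong refl)
      fix j assume "j \<in> {..<n}"
      then have "T $$ (i, j) = 0 \<or> T $$ (j, i) = 0" if "j \<noteq> i"
        using that i w(5) upper_triangularD[OF B]
        by (cases "i < j") (auto simp: T_def)
      then show "T $$ (i, j) * T $$ (j, i) = (if j = i then T $$ (i, i) * T $$ (i, i) else 0)"
        by auto
    qed
    finally show "(T * T) $$ (i, i) = (T $$ (i, i))\<^sup>2"
      using i by (simp add: power2_eq_square)
  qed
  finally have "Re (tr (E * E)) = (\<Sum>i<n. Re ((T $$ (i, i))\<^sup>2))"
    by simp
  also have "\<dots> \<le> 0"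
  proof (rule sum_nonpos)
    fix i assume "i \<in> {..<n}"
    then have i: "i < n" by simp
    then have "B $$ (i, i) \<in> set es"
      using diag w(5) by (auto simp: diag_mat_def)
    then have "Re (T $$ (i, i)) = 0"
      using Re_es i w(5) by (simp add: T_def)
    then show "Re ((T $$ (i, i))\<^sup>2) \<le> 0"
      by (simp add: power2_eq_square)
  qed
  finally have "Re (tr (E * E)) \<le> 0" .
  moreover have "Re (tr (E * E)) = (\<Sum>i<n. \<Sum>j<n. (cmod (E $$ (i, j)))\<^sup>2)"
  proof -
    have "tr (E * E) = (\<Sum>i<n. \<Sum>j<n. E $$ (i, j) * E $$ (j, i))"
      using ET by (simp add: tr_def scalar_prod_def lessThan_atLeast0)
    also have "\<dots> = (\<Sum>i<n. \<Sum>j<n. of_real ((cmod (E $$ (i, j)))\<^sup>2))"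
    proof (intro sum.cong refl)
      fix i j assume "i \<in> {..<n}" "j \<in> {..<n}"
      then show "E $$ (i, j) * E $$ (j, i) = of_real ((cmod (E $$ (i, j)))\<^sup>2)"
        by (simp add: E_herm[of i j] complex_norm_square del: of_real_power)
    qed
    finally show ?thesis by simp
  qed
  ultimately have "(\<Sum>i<n. \<Sum>j<n. (cmod (E $$ (i, j)))\<^sup>2) \<le> 0"
    by simp
  moreover have "(cmod (E $$ (a, b)))\<^sup>2 \<le> (\<Sum>j<n. (cmod (E $$ (a, j)))\<^sup>2)"
    using b by (intro member_le_sum) auto
  moreover have "(\<Sum>j<n. (cmod (E $$ (a, j)))\<^sup>2) \<le> (\<Sum>i<n. \<Sum>j<n. (cmod (E $$ (i, j)))\<^sup>2)"
    using a by (intro member_le_sum[of a "{..<n}" "\<lambda>i. \<Sum>j<n. (cmod (E $$ (i, j)))\<^sup>2"]) (auto intro: sum_nonneg)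
  ultimately have "(cmod (E $$ (a, b)))\<^sup>2 \<le> 0"
    by linarith
  then have "E $$ (a, b) = 0" by simp
  then show ?thesis
    using a b H by (auto simp: E_def split: if_splits)
qed

subsection \<open>Moment polytopes of free families\<close>

lemma sq_norm_pos:
  assumes "w \<in> tensors n d" "w \<noteq> zero_tensor"
  shows "0 < sq_norm n d w"
proof -
  obtain x where "w x \<noteq> 0"
    using assms(2) by (auto simp: zero_tensor_def)
  moreover from this have "x \<in> multi_indices n d"
    using assms(1) by (auto simp: tensors_def)
  ultimately show ?thesis
    unfolding sq_norm_def by (intro sum_pos2[of _ x]) (auto simp: finite_multi_indices)
qed

lemma continuous_on_eval: "continuous_on UNIV (\<lambda>w :: nat list \<Rightarrow> complex. w x)"
  by (rule continuous_on_product_coordinates)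

lemma continuous_on_sq_norm: "continuous_on UNIV (sq_norm n d)"
  unfolding sq_norm_def by (intro continuous_intros continuous_on_eval)

lemma continuous_on_reduced_form: "continuous_on UNIV (\<lambda>w. reduced_form n d k w a b)"
proof -
  have "continuous_on UNIV (\<lambda>w :: nat list \<Rightarrow> complex. if P then w x * cnj (w y) else 0)" for P x y
    by (cases P) (simp_all add: continuous_intros continuous_on_eval)
  then show ?thesis
    unfolding reduced_form_def by (intro continuous_on_sum)
qed

text \<open>Limits of orbit elements thus vanish off the multi-indices as well, so a nonzero limit
  has positive norm.\<close>

lemma closed_tensors: "closed (tensors n d)"
proof -
  have "tensors n d = (\<Inter>x\<in>- multi_indices n d. {w. w x = 0})"
    by (auto simp: tensors_def)
  then show ?thesis
    by (auto intro!: closed_INT closed_Collect_eq continuous_on_eval)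
qed

text \<open>The bound for the orbit is a closed condition, so it passes to the closure.\<close>

lemma zero_notin_moment_polytope:
  fixes lam :: "nat \<Rightarrow> nat \<Rightarrow> real"
  assumes n: "n > 0" and d: "d > 0" and c: "c > 0"
    and lam0: "\<And>k. k < d \<Longrightarrow> (\<Sum>a<n. lam k a) = 0"
    and supp: "\<And>x. x \<in> multi_indices n d \<Longrightarrow> v x \<noteq> 0 \<Longrightarrow> c \<le> (\<Sum>k<d. lam k (x ! k))"
  shows "zero_point \<notin> moment_polytope n d v"
proof
  assume "zero_point \<in> moment_polytope n d v"
  then obtain w where mp: "zero_point = moment_point n d w"
    and "w \<in> closure (tensor_orbit n d v) - {zero_tensor}"
    unfolding moment_polytope_def by (rule imageE)
  then have w: "w \<in> closure (tensor_orbit n d v)" "w \<noteq> zero_tensor"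
    by simp_all
  \<comment> \<open>The Kronecker symbol is written as a factor, not as a choice between terms, so
    that continuity follows termwise.\<close>
  define F where "F w = (\<Sum>k<d. (\<Sum>i<n. \<bar>lam k i\<bar>) * (\<Sum>a<n. \<Sum>b<n.
    cmod (reduced_form n d k w a b - (if a = b then 1 else 0) * of_real (sq_norm n d w / n))))" for w
  have if_eq: "(if P then 1 else 0) * z = (if P then z else 0)" for P and z :: complex
    by simp
  have "continuous_on UNIV F"
    unfolding F_def
    by (intro continuous_intros continuous_on_reduced_form continuous_on_sq_norm) (use n in auto)
  then have "closed {w. c * sq_norm n d w \<le> F w}"
    by (intro closed_Collect_le continuous_intros continuous_on_sq_norm)
  then have cl: "closed (tensors n d \<inter> {w. c * sq_norm n d w \<le> F w})"
    by (intro closed_Int closed_tensors)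
  have "tensor_orbit n d v \<subseteq> tensors n d \<inter> {w. c * sq_norm n d w \<le> F w}"
  proof
    fix x assume "x \<in> tensor_orbit n d v"
    then obtain g where x: "x = tensor_action n d g v"
      by (auto simp: tensor_orbit_def)
    have "c * sq_norm n d x \<le> F x"
      using orbit_marginals_lower_bound[of n d lam v c g, OF n d lam0 supp]
      unfolding x F_def if_eq .
    moreover have "x \<in> tensors n d"
      by (simp add: x tensors_def tensor_action_def)
    ultimately show "x \<in> tensors n d \<inter> {w. c * sq_norm n d w \<le> F w}"
      by simp
  qed
  then have "w \<in> tensors n d \<inter> {w. c * sq_norm n d w \<le> F w}"
    using closure_minimal[OF _ cl] w(1) by blast
  then have wt: "w \<in> tensors n d" and le: "c * sq_norm n d w \<le> F w"
    by auto
  have N: "sq_norm n d w > 0"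
    by (rule sq_norm_pos[OF wt w(2)])
  \<comment> \<open>A zero moment point means constant spectrum \<open>1 / n\<close>, hence
    marginals equal to the identity divided by \<open>n\<close>. The bound then fails, as
    \<open>w\<close> has positive norm.\<close>
  have "F w = 0"
    unfolding F_def
  proof (intro sum.neutral ballI)
    fix k assume "k \<in> {..<d}"
    then have k: "k < d" by simp
    have "reduced_form n d k w a b = (if a = b then 1 else 0) * of_real (sq_norm n d w / n)"
      if ab: "a < n" "b < n" for a b
    proof -
      have "marginal n d k w $$ (a, b) = (if a = b then of_real (1 / n) else 0)"
      proof (rule hermitian_const_spec[OF marginal_carrier _ _ ab])
        show "marginal n d k w $$ (j, i) = cnj (marginal n d k w $$ (i, j))" if "i < n" "j < n" for i j
          using that by (simp add: marginal_index[OF k] reduced_form_cnj)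
        show "spec (marginal n d k w) ! i = 1 / n" if "i < n" for i
          using fun_cong[OF fun_cong[OF mp, of k], of i] k that
          by (simp add: moment_point_def zero_point_def)
      qed
      then show ?thesis
        using N by (auto simp: marginal_index[OF k ab] field_simps split: if_splits)
    qed
    then show "(\<Sum>i<n. \<bar>lam k i\<bar>) * (\<Sum>a<n. \<Sum>b<n. cmod (reduced_form n d k w a b -
        (if a = b then 1 else 0) * of_real (sq_norm n d w / n))) = 0"
      by simp
  qed
  moreover have "c * sq_norm n d w > 0"
    using c N by simp
  ultimately show False
    using le by simp
qed

lemma tensor_action_one:
  assumes "v \<in> tensors n d"
  shows "tensor_action n d (\<lambda>_. 1\<^sub>m n) v = v"
proof
  fix x
  show "tensor_action n d (\<lambda>_. 1\<^sub>m n) v x = v x"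
  proof (cases "x \<in> multi_indices n d")
    case True
    have "tensor_action n d (\<lambda>_. 1\<^sub>m n) v x = (\<Sum>y\<in>multi_indices n d. if x = y then v y else 0)"
    proof -
      have "(\<Prod>k<d. (1\<^sub>m n :: complex mat) $$ (x ! k, y ! k)) = (if x = y then 1 else 0)"
        if y: "y \<in> multi_indices n d" for y
      proof (cases "x = y")
        case True
        then show ?thesis
          using multi_indices_nth_less[OF y] by (auto intro!: prod.neutral)
      next
        case False
        then obtain k where k: "k < d" "x ! k \<noteq> y ! k"
          using \<open>x \<in> multi_indices n d\<close> y by (auto simp: multi_indices_def list_eq_iff_nth_eq)
        then have "(\<Prod>k<d. (1\<^sub>m n :: complex mat) $$ (x ! k, y ! k)) = 0"
          using multi_indices_nth_less[OF y] multi_indices_nth_less[OF \<open>x \<in> multi_indices n d\<close>]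
          by (intro prod_zero) (auto intro!: bexI[of _ k])
        then show ?thesis using False by simp
      qed
      then show ?thesis
        using True unfolding tensor_action_def by (auto intro!: sum.cong)
    qed
    then show ?thesis
      using True by (simp add: finite_multi_indices)
  next
    case False
    then show ?thesis
      using assms by (simp add: tensor_action_def tensors_def)
  qed
qed

lemma moment_point_in_polytope:
  assumes "v \<in> tensors n d" "v \<noteq> zero_tensor"
  shows "moment_point n d v \<in> moment_polytope n d v"
proof -
  have "v \<in> tensor_orbit n d v"
    unfolding tensor_orbit_def
    by (intro image_eqI[of _ _ "\<lambda>_. 1\<^sub>m n"]) (simp_all add: tensor_action_one[OF assms(1)] SL_tuples_def)
  then show ?thesis
    using assms(2) closure_subset by (auto simp: moment_polytope_def)
qed

lemma dist_from_zero_nonneg: "P \<noteq> {} \<Longrightarrow> 0 \<le> dist_from_zero n d P"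
  unfolding dist_from_zero_def by (intro cINF_greatest real_sqrt_ge_zero sum_nonneg) auto

text \<open>\<open>v\<close> itself provides a point of the polytope. Diagonal marginals are upper
  triangular, so their diagonals list the eigenvalues, and sorting does not change a sum of
  squares.\<close>

lemma dist_moment_polytope_le:
  assumes v: "v \<in> tensors n d" "v \<noteq> zero_tensor"
    and diag: "\<And>k a b. k < d \<Longrightarrow> a < n \<Longrightarrow> b < n \<Longrightarrow> a \<noteq> b \<Longrightarrow> reduced_form n d k v a b = 0"
  shows "dist_from_zero n d (moment_polytope n d v)
    \<le> sqrt (\<Sum>k<d. \<Sum>a<n. ((\<Sum>x | x \<in> multi_indices n d \<and> x ! k = a. (cmod (v x))\<^sup>2) / sq_norm n d v - 1 / n)\<^sup>2)"
proof -
  have "dist_from_zero n d (moment_polytope n d v)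
      \<le> sqrt (\<Sum>k<d. \<Sum>i<n. (moment_point n d v k i)\<^sup>2)"
    unfolding dist_from_zero_def using moment_point_in_polytope[OF v]
    by (intro cINF_lower bdd_belowI[of _ 0]) (auto intro!: sum_nonneg)
  also have "(\<Sum>k<d. \<Sum>i<n. (moment_point n d v k i)\<^sup>2) = (\<Sum>k<d. \<Sum>a<n.
      ((\<Sum>x | x \<in> multi_indices n d \<and> x ! k = a. (cmod (v x))\<^sup>2) / sq_norm n d v - 1 / n)\<^sup>2)"
  proof (rule sum.cong[OF refl])
    fix k assume "k \<in> {..<d}"
    then have k: "k < d" by simp
    let ?H = "marginal n d k v"
    have ut: "upper_triangular ?H"
      using marginal_carrier[of n d k v]
      by (intro upper_triangularI) (simp add: marginal_index[OF k] diag[OF k])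
    have cp: "char_poly ?H = (\<Prod>e\<leftarrow>diag_mat ?H. [:- e, 1:])"
      by (rule char_poly_upper_triangular[OF marginal_carrier ut])
    have len: "length (diag_mat ?H) = n"
      using marginal_carrier[of n d k v] by (simp add: diag_mat_def)
    have "(\<Sum>i<n. (moment_point n d v k i)\<^sup>2) = (\<Sum>i<n. (spec ?H ! i - 1 / n)\<^sup>2)"
      using k by (simp add: moment_point_def)
    also have "\<dots> = (\<Sum>e\<leftarrow>diag_mat ?H. (Re e - 1 / n)\<^sup>2)"
      using sum_spec_factorized[OF cp, of "\<lambda>t. (t - 1 / n)\<^sup>2"] by (simp add: len)
    also have "\<dots> = (\<Sum>a<n. (Re (?H $$ (a, a)) - 1 / n)\<^sup>2)"
      using marginal_carrier[of n d k v]
      by (simp add: diag_mat_def comp_def interv_sum_list_conv_sum_set_nat lessThan_atLeast0)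
    also have "\<dots> = (\<Sum>a<n. ((\<Sum>x | x \<in> multi_indices n d \<and> x ! k = a. (cmod (v x))\<^sup>2) / sq_norm n d v - 1 / n)\<^sup>2)"
      by (intro sum.cong refl) (simp add: marginal_index[OF k] reduced_form_diag[OF k] flip: of_real_divide of_real_sum of_real_power)
    finally show "(\<Sum>i<n. (moment_point n d v k i)\<^sup>2) = (\<Sum>a<n.
      ((\<Sum>x | x \<in> multi_indices n d \<and> x ! k = a. (cmod (v x))\<^sup>2) / sq_norm n d v - 1 / n)\<^sup>2)" .
  qed
  finally show ?thesis .
qed

text \<open>
  The tensor is supported on the family \<open>X\<close> with squared amplitudes \<open>q\<close>. As no two members of the
  family differ in just one leg, its marginals are diagonal.
\<close>

lemma tensor_of_free_family:
  fixes X :: "'e \<Rightarrow> nat list" and q :: "'e \<Rightarrow> real" and lam :: "nat \<Rightarrow> nat \<Rightarrow> real"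
  assumes n: "n > 0" and d: "d > 0" and I: "finite I"
    and q: "\<And>e. e \<in> I \<Longrightarrow> 0 < q e" and q_sum: "(\<Sum>e\<in>I. q e) = n"
    and X: "\<And>e. e \<in> I \<Longrightarrow> X e \<in> multi_indices n d"
    and free: "\<And>e f k. e \<in> I \<Longrightarrow> f \<in> I \<Longrightarrow> e \<noteq> f \<Longrightarrow> k < d \<Longrightarrow> \<exists>l<d. l \<noteq> k \<and> X e ! l \<noteq> X f ! l"
    and lam0: "\<And>k. k < d \<Longrightarrow> (\<Sum>a<n. lam k a) = 0" and c: "c > 0"
    and lam: "\<And>e. e \<in> I \<Longrightarrow> c \<le> (\<Sum>k<d. lam k (X e ! k))"
  shows "\<exists>v \<in> tensors n d. v \<noteq> zero_tensor \<and> zero_point \<notin> moment_polytope n d v \<and>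
    dist_from_zero n d (moment_polytope n d v)
      \<le> sqrt (\<Sum>k<d. \<Sum>a<n. ((\<Sum>e | e \<in> I \<and> X e ! k = a. q e) - 1)\<^sup>2) / n"
proof -
  have inj: "inj_on X I"
    using free[OF _ _ _ d] by (metis inj_onI)
  define v where "v x = (if x \<in> X ` I then complex_of_real (sqrt (q (the_inv_into I X x))) else 0)" for x
  have v_X: "(cmod (v (X e)))\<^sup>2 = q e" if "e \<in> I" for e
    using that q[OF that] by (simp add: v_def the_inv_into_f_f[OF inj])
  have v_ne: "v x \<noteq> 0 \<Longrightarrow> x \<in> X ` I" for x
    by (auto simp: v_def split: if_splits)
  have vt: "v \<in> tensors n d"
    using v_ne X by (fastforce simp: tensors_def)
  have sub: "X ` I \<subseteq> multi_indices n d"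
    using X by auto
  have sum_v: "(\<Sum>x | x \<in> multi_indices n d \<and> P x. (cmod (v x))\<^sup>2) = (\<Sum>e | e \<in> I \<and> P (X e). q e)" for P
  proof -
    have "(\<Sum>x | x \<in> multi_indices n d \<and> P x. (cmod (v x))\<^sup>2) = (\<Sum>x\<in>X ` {e \<in> I. P (X e)}. (cmod (v x))\<^sup>2)"
      using sub v_ne by (intro sum.mono_neutral_right) (auto simp: finite_multi_indices)
    also have "\<dots> = (\<Sum>e | e \<in> I \<and> P (X e). (cmod (v (X e)))\<^sup>2)"
      by (subst sum.reindex) (auto intro: inj_on_subset[OF inj])
    finally show ?thesis
      using v_X by simp
  qed
  \<comment> \<open>With total mass \<open>n\<close>, a uniform leg has mass 1 at every letter, and
    normalising divides deviations by \<open>n\<close>.\<close>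
  have N: "sq_norm n d v = n"
    unfolding sq_norm_def q_sum[symmetric] using sum_v[of "\<lambda>_. True"] by simp
  then have v0: "v \<noteq> zero_tensor"
    using n by (auto simp: sq_norm_def zero_tensor_def)
  have "zero_point \<notin> moment_polytope n d v"
    using v_ne lam by (intro zero_notin_moment_polytope[OF n d c lam0]) blast+
  moreover have diag: "reduced_form n d k v a b = 0" if k: "k < d" and ab: "a \<noteq> b" for k a b
    unfolding reduced_form_def
  proof (intro sum.neutral ballI)
    fix x y
    show "(if x ! k = a \<and> y ! k = b \<and> agree_off d k x y then v x * cnj (v y) else 0) = 0"
    proof (rule ccontr)
      assume "\<not> ?thesis"
      then have xy: "x ! k = a" "y ! k = b" "agree_off d k x y" "v x \<noteq> 0" "v y \<noteq> 0"
        by (auto split: if_splits)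
      then obtain e f where "e \<in> I" "f \<in> I" "x = X e" "y = X f"
        using v_ne by blast
      then show False
        using free[of e f k] xy k ab by (auto simp: agree_off_def)
    qed
  qed
  moreover have "sqrt (\<Sum>k<d. \<Sum>a<n. ((\<Sum>x | x \<in> multi_indices n d \<and> x ! k = a. (cmod (v x))\<^sup>2) / sq_norm n d v - 1 / n)\<^sup>2)
    = sqrt (\<Sum>k<d. \<Sum>a<n. ((\<Sum>e | e \<in> I \<and> X e ! k = a. q e) - 1)\<^sup>2) / n"
  proof -
    have "(\<Sum>k<d. \<Sum>a<n. ((\<Sum>x | x \<in> multi_indices n d \<and> x ! k = a. (cmod (v x))\<^sup>2) / sq_norm n d v - 1 / n)\<^sup>2)
      = (\<Sum>k<d. \<Sum>a<n. ((\<Sum>e | e \<in> I \<and> X e ! k = a. q e) - 1)\<^sup>2) / (real n)\<^sup>2"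
      unfolding N sum_v by (simp add: diff_divide_distrib[symmetric] power_divide flip: sum_divide_distrib)
    then show ?thesis
      by (simp add: real_sqrt_divide)
  qed
  ultimately show ?thesis
    using vt v0 dist_moment_polytope_le[OF vt v0] by (intro bexI[of _ v]) auto
qed

text \<open>The common end of both constructions: at most four entries deviate, each by
  \<open>eps\<close>, so the norm is at most \<open>2 * eps\<close>, and dividing by
  \<open>n\<close> brings it down to \<open>eps\<close>. The exactly uniform leg \<open>u\<close>
  yields the total mass \<open>n\<close>.\<close>

lemma tensor_of_nearly_uniform_family:
  fixes X :: "'e \<Rightarrow> nat list" and q :: "'e \<Rightarrow> real" and lam :: "nat \<Rightarrow> nat \<Rightarrow> real"
  assumes n: "n \<ge> 2" and I: "finite I"
    and q: "\<And>e. e \<in> I \<Longrightarrow> 0 < q e"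
    and X: "\<And>e. e \<in> I \<Longrightarrow> X e \<in> multi_indices n d"
    and free: "\<And>e f k. e \<in> I \<Longrightarrow> f \<in> I \<Longrightarrow> e \<noteq> f \<Longrightarrow> k < d \<Longrightarrow> \<exists>l<d. l \<noteq> k \<and> X e ! l \<noteq> X f ! l"
    and lam0: "\<And>k. k < d \<Longrightarrow> (\<Sum>a<n. lam k a) = 0" and c: "c > 0"
    and lam: "\<And>e. e \<in> I \<Longrightarrow> c \<le> (\<Sum>k<d. lam k (X e ! k))"
    and dev: "\<And>k a. k < d \<Longrightarrow> a < n \<Longrightarrow>
      \<bar>(\<Sum>e | e \<in> I \<and> X e ! k = a. q e) - 1\<bar> = (if (k = p \<or> k = Suc p) \<and> a < 2 then eps else 0)"
    and u: "u < d" "u \<noteq> p" "u \<noteq> Suc p" and eps: "eps \<ge> 0"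
  shows "\<exists>v \<in> tensors n d. v \<noteq> zero_tensor \<and> zero_point \<notin> moment_polytope n d v \<and>
    dist_from_zero n d (moment_polytope n d v) \<le> eps"
proof -
  have "(\<Sum>e\<in>I. q e) = (\<Sum>a<n. \<Sum>e | e \<in> I \<and> X e ! u = a. q e)"
    by (rule sum.group[symmetric]) (use I multi_indices_nth_less[OF X u(1)] in auto)
  also have "\<dots> = (\<Sum>a<n. 1)"
    using dev[OF u(1)] u by (intro sum.cong refl) simp
  finally have q_sum: "(\<Sum>e\<in>I. q e) = n"
    by simp
  have dev_sq: "((\<Sum>e | e \<in> I \<and> X e ! k = a. q e) - 1)\<^sup>2
      = (if k = p \<or> k = Suc p then if a < 2 then eps\<^sup>2 else 0 else 0)" if "k < d" "a < n" for k a
    using arg_cong[OF dev[OF that], of "\<lambda>t. t\<^sup>2"] by (auto split: if_splits)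
  have "(\<Sum>k<d. \<Sum>a<n. ((\<Sum>e | e \<in> I \<and> X e ! k = a. q e) - 1)\<^sup>2)
      = (\<Sum>k<d. if k = p \<or> k = Suc p then \<Sum>a<n. if a < 2 then eps\<^sup>2 else 0 else 0)"
    using dev_sq by (intro sum.cong[OF refl]) simp
  also have "(\<Sum>a<n. if a < 2 then eps\<^sup>2 else 0) = (\<Sum>a<2::nat. eps\<^sup>2)"
    using n by (intro sum.mono_neutral_cong_right) auto
  also have "(\<Sum>k<d. if k = p \<or> k = Suc p then \<Sum>a<2::nat. eps\<^sup>2 else 0)
      = (\<Sum>k\<in>{..<d} \<inter> {p, Suc p}. \<Sum>a<2::nat. eps\<^sup>2)"
    by (subst sum.inter_restrict) (auto intro!: sum.cong)
  also have "\<dots> \<le> (\<Sum>k\<in>{p, Suc p}. \<Sum>a<2::nat. eps\<^sup>2)"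
    by (intro sum_mono2) (auto intro: sum_nonneg)
  also have "\<dots> = (2 * eps)\<^sup>2"
    by (simp add: power2_eq_square)
  finally have "sqrt (\<Sum>k<d. \<Sum>a<n. ((\<Sum>e | e \<in> I \<and> X e ! k = a. q e) - 1)\<^sup>2) \<le> 2 * eps"
    using eps by (intro real_le_lsqrt) auto
  then have "sqrt (\<Sum>k<d. \<Sum>a<n. ((\<Sum>e | e \<in> I \<and> X e ! k = a. q e) - 1)\<^sup>2) / n \<le> 2 * eps / n"
    by (intro divide_right_mono) auto
  also have "\<dots> \<le> eps"
    using n eps mult_right_mono[of 2 "real n" eps] by (simp add: divide_le_eq mult.commute)
  finally have "sqrt (\<Sum>k<d. \<Sum>a<n. ((\<Sum>e | e \<in> I \<and> X e ! k = a. q e) - 1)\<^sup>2) / n \<le> eps" .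
  moreover have "n > 0" "d > 0"
    using n u by auto
  then have "\<exists>v \<in> tensors n d. v \<noteq> zero_tensor \<and> zero_point \<notin> moment_polytope n d v \<and>
    dist_from_zero n d (moment_polytope n d v)
      \<le> sqrt (\<Sum>k<d. \<Sum>a<n. ((\<Sum>e | e \<in> I \<and> X e ! k = a. q e) - 1)\<^sup>2) / n"
    by (rule tensor_of_free_family[where lam = lam and c = c])
      (fact I q q_sum X free lam0 c lam)+
  ultimately show ?thesis
    by (meson order.trans)
qed

subsection \<open>A single ladder\<close>

text \<open>Names for the members of both families, which keep members apart before their
  multi-indices are known to differ. The single ladder has no \<open>C\<close>.\<close>

datatype label = G nat | A nat | B nat | C nat

lemma sum_labels:
  fixes f :: "label \<Rightarrow> real"
  assumes "finite S" "finite T" "finite U"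
  shows "(\<Sum>e\<in>G ` S \<union> A ` T \<union> B ` T \<union> C ` U. f e)
    = (\<Sum>s\<in>S. f (G s)) + (\<Sum>s\<in>T. f (A s)) + (\<Sum>s\<in>T. f (B s)) + (\<Sum>s\<in>U. f (C s))"
proof -
  have inj: "inj_on G S" "inj_on A T" "inj_on B T" "inj_on C U"
    by (auto simp: inj_on_def)
  have "(\<Sum>e\<in>G ` S \<union> A ` T \<union> B ` T \<union> C ` U. f e)
    = sum f (G ` S) + sum f (A ` T) + sum f (B ` T) + sum f (C ` U)"
    using assms by (subst sum.union_disjoint, auto)+
  then show ?thesis
    by (simp add: sum.reindex[OF inj(1)] sum.reindex[OF inj(2)] sum.reindex[OF inj(3)] sum.reindex[OF inj(4)])
qed

lemma sum_half_powers: "(\<Sum>s\<in>{1..<n}. (1 / 2 :: real) ^ s) = 1 - (1 / 2) ^ (n - 1)" if "n \<ge> 1"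
  using that
proof (induction n rule: dec_induct)
  case (step m)
  then show ?case by (cases m) simp_all
qed simp

lemma sum_half_powers_rev: "(\<Sum>s\<in>{1..<n}. (1 / 2 :: real) ^ (n - s)) = 1 - (1 / 2) ^ (n - 1)" if "n \<ge> 1"
proof -
  have "(\<Sum>s\<in>{1..<n}. (1 / 2 :: real) ^ (n - s)) = (\<Sum>s\<in>{1..<n}. (1 / 2) ^ s)"
    by (rule sum.reindex_bij_witness[of _ "\<lambda>s. n - s" "\<lambda>s. n - s"]) auto
  then show ?thesis
    using sum_half_powers[OF that] by simp
qed

text \<open>
  In legs \<open>0, 1, 2\<close> the family consists of \<open>(s, 0, s)\<close>, \<open>(s, s, 0)\<close> and \<open>(s - 1, s, s)\<close> for
  \<open>1 \<le> s < n\<close>; the remaining legs repeat leg \<open>0\<close>. Uniformity of leg \<open>0\<close> forces the weight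
  \<open>2\<^bsup>s-n\<^esup>\<close> of the first two kinds, which leaves an excess \<open>2\<^bsup>1-n\<^esup>\<close> at letter \<open>1\<close> of legs \<open>1\<close> and \<open>2\<close>.
\<close>

lemma tensor_near_uniform_in_n:
  assumes n: "n \<ge> 2" and d: "d \<ge> 3"
  shows "\<exists>v \<in> tensors n d. v \<noteq> zero_tensor \<and> zero_point \<notin> moment_polytope n d v \<and>
    dist_from_zero n d (moment_polytope n d v) \<le> (1 / 2) ^ (n - 1)"
proof -
  define letter where "letter k e = (case e of G s \<Rightarrow> if k = 1 \<or> k = 2 then s else s - 1
    | A s \<Rightarrow> if k = 1 then 0 else s | B s \<Rightarrow> if k = 2 then 0 else s | C s \<Rightarrow> 0)" for k :: nat and e
  define X where "X e = map (\<lambda>k. letter k e) [0..<d]" for e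
  \<comment> \<open>Only \<open>G 1\<close> meets letter 0 of leg 0, so it must have weight 1; this
    breaks the pattern \<open>1 - (1 / 2) ^ (n - s)\<close> at \<open>s = 1\<close> and puts the
    excess at letter 1 of legs 1 and 2.\<close>
  define q where "q e = (case e of G s \<Rightarrow> if s = 1 then 1 else 1 - (1 / 2) ^ (n - s)
    | A s \<Rightarrow> (1 / 2) ^ (n - s) | B s \<Rightarrow> (1 / 2) ^ (n - s) | C s \<Rightarrow> (1 :: real))" for e
  let ?S = "{1..<n}"
  define I where "I = G ` ?S \<union> A ` ?S \<union> B ` ?S \<union> C ` {}"
  define eta where "eta = (1 / 2 :: real) ^ (n - 1)"
  \<comment> \<open>Before centring, \<open>nu a\<close> is \<open>- (1 / 2) ^ a\<close> and
    \<open>mu a\<close> is \<open>(1 / 2) ^ a\<close>, or 0 for \<open>a = 0\<close>, so the weights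
    of each member cancel. The centring constants leave
    \<open>(2 - eta) / n - 2 * (1 - eta) / n = eta / n\<close>.\<close>
  define mu where "mu a = (if a = 0 then 0 else (1 / 2) ^ a) - (1 - eta) / n" for a :: nat
  define nu where "nu a = (2 - eta) / n - (1 / 2) ^ a" for a :: nat
  define lam where "lam k = (if k = 0 then nu else if k = 1 \<or> k = 2 then mu else (\<lambda>_. 0))" for k :: nat
  have eta: "eta > 0" by (simp add: eta_def)
  have X_nth: "X e ! k = letter k e" if "k < d" for e k
    using that by (simp add: X_def)
  have half: "(1 / 2 :: real) ^ (n - s) < 1" if "s \<in> ?S" for s
    using that by (simp add: power_less_one_iff)
  have count: "(\<Sum>e | e \<in> I \<and> X e ! k = a. q e)
      = (\<Sum>s\<in>?S. if letter k (G s) = a then q (G s) else 0)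
      + (\<Sum>s\<in>?S. if letter k (A s) = a then q (A s) else 0)
      + (\<Sum>s\<in>?S. if letter k (B s) = a then q (B s) else 0)" if "k < d" for k a
  proof -
    have "(\<Sum>e | e \<in> I \<and> X e ! k = a. q e) = (\<Sum>e\<in>I. if letter k e = a then q e else 0)"
      using that by (subst sum.inter_filter) (simp_all add: I_def X_nth)
    then show ?thesis
      unfolding I_def by (subst (asm) sum_labels) simp_all
  qed
  have q_B: "q (B s) = q (A s)" for s
    by (simp add: q_def)
  \<comment> \<open>\<open>s\<close> is at least 1 on \<open>?S\<close>, so \<open>s - 1\<close>
    does not truncate.\<close>
  have shift: "(\<Sum>s\<in>?S. if s - 1 = a then f s else 0) = (if Suc a < n then f (Suc a) else 0)"
    for a and f :: "nat \<Rightarrow> real"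
  proof -
    have "(\<Sum>s\<in>?S. if s - 1 = a then f s else 0) = (\<Sum>s\<in>?S. if s = Suc a then f s else 0)"
      by (intro sum.cong refl) auto
    then show ?thesis by simp
  qed
  show ?thesis
    unfolding eta_def[symmetric]
  proof (rule tensor_of_nearly_uniform_family[where I = I and X = X and q = q and lam = lam
        and c = "eta / n" and p = 1 and u = 0])
    show "0 < q e" if "e \<in> I" for e
      using that half by (auto simp: I_def q_def)
    show "X e \<in> multi_indices n d" if "e \<in> I" for e
      using that by (auto simp: I_def X_def multi_indices_def letter_def)
    show "\<exists>l<d. l \<noteq> k \<and> X e ! l \<noteq> X f ! l" if "e \<in> I" "f \<in> I" "e \<noteq> f" "k < d" for e f k
    proof -
      \<comment> \<open>Two members differ in at least two of the legs 0, 1, 2. For instance,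
        \<open>G s\<close> and \<open>A i\<close> differ in leg 1, and equality in legs 0 and 2
        would give \<open>s - 1 = i = s\<close>.\<close>
      have "\<exists>l\<in>{0, 1, 2}. l \<noteq> k \<and> letter l e \<noteq> letter l f"
        using that by (auto simp: I_def letter_def)
      then obtain l where l: "l \<in> {0, 1, 2}" "l \<noteq> k" "letter l e \<noteq> letter l f"
        by blast
      then have "l < d"
        using d by auto
      then show ?thesis
        using l X_nth by (intro exI[of _ l]) simp
    qed
    show "(\<Sum>a<n. lam k a) = 0" for k
    proof -
      have n1: "{..<n} = insert 0 {1..<n}"
        using n by auto
      have "(\<Sum>a<n. mu a) = (\<Sum>a<n. if a = 0 then 0 else (1 / 2) ^ a) - (1 - eta)"
        using n by (simp add: mu_def sum_subtractf)
      also have "(\<Sum>a<n. if a = 0 then 0 else (1 / 2 :: real) ^ a) = (\<Sum>a\<in>{1..<n}. (1 / 2) ^ a)"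
        by (intro sum.mono_neutral_cong_right) auto
      finally have "(\<Sum>a<n. mu a) = 0"
        using sum_half_powers[of n] n by (simp add: eta_def)
      moreover have "(\<Sum>a<n. nu a) = 2 - eta - (\<Sum>a<n. (1 / 2) ^ a)"
        using n by (simp add: nu_def sum_subtractf)
      then have "(\<Sum>a<n. nu a) = 0"
        unfolding n1 using sum_half_powers[of n] n by (simp add: eta_def)
      ultimately show ?thesis
        by (simp add: lam_def)
    qed
    show "eta / n \<le> (\<Sum>k<d. lam k (X e ! k))" if "e \<in> I" for e
    proof -
      have "(\<Sum>k<d. lam k (X e ! k)) = (\<Sum>k<3. lam k (letter k e))"
        using d by (intro sum.mono_neutral_cong_right) (auto simp: lam_def X_nth)
      also have "\<dots> = nu (letter 0 e) + mu (letter 1 e) + mu (letter 2 e)"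
        by (simp add: lam_def eval_nat_numeral)
      also have "\<dots> = eta / n"
      proof -
        have "(1 / 2 :: real) ^ (s - 1) = 2 * (1 / 2) ^ s" if "1 \<le> s" for s
          using that by (cases s) simp_all
        then show ?thesis
          using that n by (auto simp: I_def letter_def mu_def nu_def field_simps)
      qed
      finally show ?thesis by simp
    qed
    show "\<bar>(\<Sum>e | e \<in> I \<and> X e ! k = a. q e) - 1\<bar> = (if (k = 1 \<or> k = Suc 1) \<and> a < 2 then eta else 0)"
      if k: "k < d" and a: "a < n" for k a
    proof (cases "k = 1 \<or> k = 2")
      case True
      have "(\<Sum>e | e \<in> I \<and> X e ! k = a. q e) = (\<Sum>s\<in>?S. if s = a then q (G s) else 0)
          + (\<Sum>s\<in>?S. if 0 = a then q (A s) else 0) + (\<Sum>s\<in>?S. if s = a then q (A s) else 0)"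
        unfolding count[OF k] q_B using True by (elim disjE) (simp_all add: letter_def)
      also have "\<dots> = (if a = 0 then 1 - eta else q (G a) + q (A a))"
        using a n sum_half_powers_rev[of n] by (simp add: eta_def q_def)
      also have "\<dots> = (if a = 0 then 1 - eta else if a = 1 then 1 + eta else 1)"
        by (simp add: q_def eta_def)
      finally show ?thesis
        using True eta by auto
    next
      case False
      have "(\<Sum>e | e \<in> I \<and> X e ! k = a. q e) = (\<Sum>s\<in>?S. if s - 1 = a then q (G s) else 0)
          + (\<Sum>s\<in>?S. if s = a then q (A s) else 0) + (\<Sum>s\<in>?S. if s = a then q (A s) else 0)"
        unfolding count[OF k] q_B using False by (simp add: letter_def)
      also have "\<dots> = (if Suc a < n then q (G (Suc a)) else 0) + (if a = 0 then 0 else 2 * q (A a))"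
        unfolding shift using a by simp
      also have "\<dots> = 1"
      proof -
        have "2 * q (A a) = (1 / 2 :: real) ^ (n - Suc a)"
          using a by (simp add: q_def Suc_diff_Suc[symmetric])
        then show ?thesis
          using a n by (cases "Suc a < n") (auto simp: q_def)
      qed
      finally show ?thesis
        using False by simp
    qed
  qed (use n d eta in \<open>auto simp: I_def\<close>)
qed

subsection \<open>Joined ladders\<close>

text \<open>
  The legs come in \<open>3 r\<close> pairs, one for each \<open>t < r\<close> and \<open>c < 3\<close>, and at least two further legs,
  which get \<open>(t, c) = (r, 0)\<close>. The index \<open>j < L\<close> stands for the letter \<open>S j\<close> in block \<open>j div m\<close>.
  The amplitudes double from \<open>j\<close> to \<open>Suc j\<close>, also when \<open>Suc j\<close> begins a new block, so that the
  deficit at \<open>j = 0\<close> is exponentially small in the number \<open>L\<close> of all indices.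
\<close>

locale block_ladder =
  fixes n d :: nat
  assumes n: "2 \<le> n" and d: "8 \<le> d"
begin

definition "r = (d - 2) div 6"
definition "m = n - 1"
definition "L = r * m"
definition S :: "nat \<Rightarrow> nat" where "S j = Suc (j mod m)"

text \<open>In its own block \<open>A j\<close> gives up the letter \<open>S j\<close>. It is
  restored by \<open>B j\<close> for \<open>c = 1\<close>, by \<open>C j\<close> for
  \<open>c = 2\<close>, and for \<open>c = 0\<close> by \<open>B\<close> and \<open>C\<close> of the
  preceding index, which have half the amplitude each. Index 0 has no predecessor, whence the
  deviation.\<close>

definition letter :: "nat \<Rightarrow> nat \<Rightarrow> label \<Rightarrow> nat" where
  "letter t c e = (case e of G s \<Rightarrow> s
    | A j \<Rightarrow> if j div m = t then 0 else S j
    | B j \<Rightarrow> if c = 1 \<and> j div m = t then S j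
        else if c = 0 \<and> Suc j < L \<and> Suc j div m = t then S (Suc j) else 0
    | C j \<Rightarrow> if c = 2 \<and> j div m = t then S j
        else if c = 0 \<and> Suc j < L \<and> Suc j div m = t then S (Suc j) else 0)"

definition leg_type :: "nat \<Rightarrow> nat" where "leg_type k = min (k div 2) (3 * r)"

definition X :: "label \<Rightarrow> nat list" where
  "X e = map (\<lambda>k. letter (leg_type k div 3) (leg_type k mod 3) e) [0..<d]"

definition I :: "label set" where "I = G ` {1..<n} \<union> A ` {..<L} \<union> B ` {..<L} \<union> C ` {..<L}"

text \<open>Chosen so that the amplitudes sum to 1/2, as the total mass \<open>n\<close> demands:
  the labels \<open>G\<close> carry \<open>n - 1 - 1 / 2\<close>, the others together
  \<open>3 / 2\<close>.\<close>

definition a0 :: real where "a0 = 1 / (2 * (2 ^ L - 1))"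
definition amp :: "nat \<Rightarrow> real" where "amp j = 2 ^ j * a0"
definition W :: "nat \<Rightarrow> real" where "W a = (\<Sum>j<L. if S j = a then amp j else 0)"

definition q :: "label \<Rightarrow> real" where
  "q e = (case e of G s \<Rightarrow> 1 - W s | A j \<Rightarrow> amp j | B j \<Rightarrow> amp j | C j \<Rightarrow> amp j)"

lemma r_pos: "1 \<le> r" and r_le: "6 * r + 2 \<le> d" and r_ge: "d \<le> 13 * r"
proof -
  have "6 * r + (d - 2) mod 6 = d - 2" "(d - 2) mod 6 < 6"
    by (simp_all add: r_def)
  moreover from this show "1 \<le> r"
    using d by (cases "r = 0") simp_all
  \<comment> \<open>Division gives \<open>d \<le> 6 * r + 7\<close>, and
    \<open>7 \<le> 7 * r\<close>; the factor 13 enters the final constant.\<close>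
  ultimately show "6 * r + 2 \<le> d" "d \<le> 13 * r"
    using d by linarith+
qed

lemma m_pos: "1 \<le> m"
  using n by (simp add: m_def)

lemma L_pos: "1 \<le> L"
  using r_pos m_pos by (simp add: L_def Suc_le_eq)

lemma S_bounds: "1 \<le> S j" "S j < n"
proof -
  have "j mod m < m" "Suc m = n"
    using m_pos n by (simp_all add: m_def)
  then show "1 \<le> S j" "S j < n"
    by (simp_all add: S_def)
qed

lemma S_ne_0 [simp]: "S j \<noteq> 0" "0 \<noteq> S j"
  by (simp_all add: S_def)

lemma block_less: "j < L \<Longrightarrow> j div m < r"
  by (simp add: L_def less_mult_imp_div_less)

lemma index_eq: "j div m = i div m \<Longrightarrow> S j = S i \<Longrightarrow> j = i"
  by (metis S_def div_mult_mod_eq nat.inject)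

lemma index_of_letter: "j div m * m + S j - 1 = j"
  by (simp add: S_def)

lemma pow_L: "(2 :: real) \<le> 2 ^ L"
  using power_increasing[of 1 L "2 :: real"] L_pos by simp

lemma a0_pos: "0 < a0"
  using pow_L by (simp add: a0_def)

lemma a0_le: "a0 \<le> (1 / 2) ^ L"
  using pow_L by (simp add: a0_def power_one_over field_simps)

lemma amp_pos: "0 < amp j"
  using a0_pos by (simp add: amp_def)

lemma amp_0: "amp 0 = a0"
  by (simp add: amp_def)

lemma amp_Suc: "amp (Suc j) = 2 * amp j"
  by (simp add: amp_def)

lemma sum_amp: "(\<Sum>j<L. amp j) = 1 / 2"
proof -
  have "(\<Sum>j<K. (2 :: real) ^ j) = 2 ^ K - 1" for K
    by (induction K) simp_all
  moreover have "(\<Sum>j<L. amp j) = (\<Sum>j<L. 2 ^ j) * a0"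
    by (simp add: amp_def sum_distrib_right)
  ultimately show ?thesis
    using pow_L by (simp add: a0_def)
qed

lemma W_le: "W a \<le> 1 / 2"
proof -
  have "W a \<le> (\<Sum>j<L. amp j)"
    unfolding W_def using amp_pos by (intro sum_mono) (simp add: less_imp_le)
  then show ?thesis
    by (simp add: sum_amp)
qed

lemma sum_W: "(\<Sum>a\<in>{1..<n}. W a) = 1 / 2"
proof -
  have "(\<Sum>a\<in>{1..<n}. W a) = (\<Sum>j<L. \<Sum>a\<in>{1..<n}. if S j = a then amp j else 0)"
    unfolding W_def by (rule sum.swap)
  also have "\<dots> = (\<Sum>j<L. amp j)"
    using S_bounds by (intro sum.cong refl) simp
  finally show ?thesis
    by (simp add: sum_amp)
qed

lemma finite_I: "finite I"
  by (simp add: I_def)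

lemma q_pos: "e \<in> I \<Longrightarrow> 0 < q e"
  using amp_pos le_less_trans[OF W_le, of 1] by (auto simp: I_def q_def)

lemma sum_q: "(\<Sum>e\<in>I. q e) = n"
proof -
  have "(\<Sum>e\<in>I. q e) = (\<Sum>s\<in>{1..<n}. 1 - W s) + 3 * (\<Sum>j<L. amp j)"
    unfolding I_def by (subst sum_labels) (simp_all add: q_def)
  then show ?thesis
    using n by (simp add: sum_subtractf sum_W[simplified] sum_amp of_nat_diff)
qed

lemma letter_less: "e \<in> I \<Longrightarrow> letter t c e < n"
  using S_bounds n by (auto simp: I_def letter_def)

lemma X_nth: "k < d \<Longrightarrow> X e ! k = letter (leg_type k div 3) (leg_type k mod 3) e"
  by (simp add: X_def)

lemma X_multi_indices: "e \<in> I \<Longrightarrow> X e \<in> multi_indices n d"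
  using letter_less by (auto simp: X_def multi_indices_def)

section \<open>Marginals of the joined ladders\<close>

definition V :: "nat \<Rightarrow> nat \<Rightarrow> real" where
  "V t a = (\<Sum>j<L. if j div m = t \<and> S j = a then amp j else 0)"

text \<open>Amplitudes double, so summing those of the predecessors halves the sum. The term lost in
  the shift is index 0, which stands for letter 1 of block 0.\<close>

lemma sum_shifted:
  "(\<Sum>j<L. if Suc j < L \<and> Suc j div m = t \<and> S (Suc j) = a then amp j else 0)
    = (V t a - (if t = 0 \<and> a = 1 then a0 else 0)) / 2"
proof -
  obtain K where K: "L = Suc K"
    using L_pos by (cases L) auto
  have "V t a = (if 0 div m = t \<and> S 0 = a then amp 0 else 0)
      + (\<Sum>j<K. if Suc j div m = t \<and> S (Suc j) = a then amp (Suc j) else 0)"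
    unfolding V_def K by (rule sum.lessThan_Suc_shift)
  also have "(\<Sum>j<K. if Suc j div m = t \<and> S (Suc j) = a then amp (Suc j) else 0)
      = 2 * (\<Sum>j<K. if Suc j div m = t \<and> S (Suc j) = a then amp j else 0)"
    unfolding sum_distrib_left by (intro sum.cong refl) (simp add: amp_Suc)
  also have "(\<Sum>j<K. if Suc j div m = t \<and> S (Suc j) = a then amp j else 0)
      = (\<Sum>j<L. if Suc j < L \<and> Suc j div m = t \<and> S (Suc j) = a then amp j else 0)"
    unfolding K by (simp add: sum.lessThan_Suc)
  finally show ?thesis
    by (auto simp: S_def amp_0)
qed

text \<open>\<open>G\<close> supplies \<open>1 - W a\<close> and \<open>A\<close> supplies
  \<open>W a - V t a\<close>. The missing \<open>V t a\<close> comes from \<open>B\<close> or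
  \<open>C\<close> alone for \<open>c = 1, 2\<close>, and for \<open>c = 0\<close> from two shifted
  halves, which fall short by \<open>a0\<close> at index 0.\<close>

lemma count_letter_pos:
  assumes a: "1 \<le> a" "a < n" and c: "c < 3"
  shows "(\<Sum>e\<in>I. if letter t c e = a then q e else 0) = 1 - (if t = 0 \<and> c = 0 \<and> a = 1 then a0 else 0)"
proof -
  let ?sh = "\<Sum>j<L. if Suc j < L \<and> Suc j div m = t \<and> S (Suc j) = a then amp j else 0"
  have G: "(\<Sum>s\<in>{1..<n}. if letter t c (G s) = a then q (G s) else 0) = 1 - W a"
    using a by (simp add: letter_def q_def)
  have "(\<Sum>j<L. if letter t c (A j) = a then q (A j) else 0) + V t a = W a"
    unfolding V_def W_def sum.distrib[symmetric]
    using a by (intro sum.cong refl) (auto simp: letter_def q_def)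
  then have A: "(\<Sum>j<L. if letter t c (A j) = a then q (A j) else 0) = W a - V t a"
    by simp
  have B: "(\<Sum>j<L. if letter t c (B j) = a then q (B j) else 0)
      = (if c = 1 then V t a else if c = 0 then ?sh else 0)"
    unfolding V_def using a by (auto simp: letter_def q_def intro!: sum.cong sum.neutral)
  have C: "(\<Sum>j<L. if letter t c (C j) = a then q (C j) else 0)
      = (if c = 2 then V t a else if c = 0 then ?sh else 0)"
    unfolding V_def using a by (auto simp: letter_def q_def intro!: sum.cong sum.neutral)
  have "c = 0 \<or> c = 1 \<or> c = 2"
    using c by auto
  then show ?thesis
    unfolding I_def by (subst sum_labels) (auto simp: G[simplified] A B C sum_shifted)
qed

text \<open>All letters together have mass \<open>n\<close>, so letter 0 has what the positive
  letters leave over.\<close>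

lemma count_letter_0:
  assumes c: "c < 3"
  shows "(\<Sum>e\<in>I. if letter t c e = 0 then q e else 0) = 1 + (if t = 0 \<and> c = 0 then a0 else 0)"
proof -
  let ?c = "\<lambda>a. \<Sum>e\<in>I. if letter t c e = a then q e else 0"
  have "(\<Sum>a<n. ?c a) = (\<Sum>e\<in>I. \<Sum>a<n. if letter t c e = a then q e else 0)"
    by (rule sum.swap)
  also have "\<dots> = n"
    unfolding sum_q[symmetric] using letter_less by (intro sum.cong refl) simp
  finally have "(\<Sum>a<n. ?c a) = n" .
  moreover have "{..<n} = insert 0 {1..<n}"
    using n by auto
  then have "(\<Sum>a<n. ?c a) = ?c 0 + (\<Sum>a\<in>{1..<n}. ?c a)"
    by simp
  moreover have "(\<Sum>a\<in>{1..<n}. ?c a) = (\<Sum>a\<in>{1..<n}. 1 - (if a = 1 then if t = 0 \<and> c = 0 then a0 else 0 else 0))"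
    using count_letter_pos[OF _ _ c, of _ t] by (intro sum.cong refl) auto
  moreover have "\<dots> = real n - 1 - (if t = 0 \<and> c = 0 then a0 else 0)"
    using n by (simp add: sum_subtractf of_nat_diff)
  ultimately show ?thesis
    by linarith
qed

lemma leg_type_zero: "leg_type k div 3 = 0 \<and> leg_type k mod 3 = 0 \<longleftrightarrow> k = 0 \<or> k = Suc 0"
  using r_pos by (auto simp: leg_type_def min_def)

lemma deviation:
  assumes k: "k < d" and a: "a < n"
  shows "\<bar>(\<Sum>e | e \<in> I \<and> X e ! k = a. q e) - 1\<bar> = (if (k = 0 \<or> k = Suc 0) \<and> a < 2 then a0 else 0)"
proof -
  have "(\<Sum>e | e \<in> I \<and> X e ! k = a. q e)
      = (\<Sum>e\<in>I. if letter (leg_type k div 3) (leg_type k mod 3) e = a then q e else 0)"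
    using k by (subst sum.inter_filter) (simp_all add: finite_I X_nth)
  also have "\<dots> = 1 + (if k = 0 \<or> k = Suc 0 then if a = 0 then a0 else if a = 1 then - a0 else 0 else 0)"
  proof (cases "a = 0")
    case True
    then show ?thesis
      using count_letter_0[of "leg_type k mod 3" "leg_type k div 3"] leg_type_zero[of k] by auto
  next
    case False
    then show ?thesis
      using count_letter_pos[of a "leg_type k mod 3" "leg_type k div 3"] leg_type_zero[of k] a by auto
  qed
  finally show ?thesis
    using a0_pos by auto
qed

section \<open>Freeness of the joined ladders\<close>

lemma letter_home:
  assumes "e \<in> I"
  shows "letter r 0 e = (case e of G s \<Rightarrow> s | A j \<Rightarrow> S j | B j \<Rightarrow> 0 | C j \<Rightarrow> 0)"
proof -
  have "j div m \<noteq> r" if "j < L" for j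
    using block_less[OF that] by simp
  then show ?thesis
    using assms by (auto simp: letter_def I_def)
qed

text \<open>The home letter, that of the legs \<open>(r, 0)\<close>, is nonzero exactly for
  \<open>G\<close> and \<open>A\<close>. In the legs of block \<open>j div m\<close> with
  \<open>c = 1\<close>, \<open>A j\<close> has 0, unlike \<open>G\<close> or an \<open>A\<close> of
  another block, and \<open>B j\<close> has \<open>S j\<close>, unlike \<open>C\<close> or a
  \<open>B\<close> of another block. The legs with \<open>c = 2\<close> do the same for
  \<open>C j\<close>. Within a block the letter fixes the index.\<close>

lemma letters_determine:
  assumes e: "e \<in> I" and f: "f \<in> I"
    and eq: "\<And>t c. t < r \<Longrightarrow> c < 3 \<Longrightarrow> letter t c e = letter t c f"
    and home: "letter r 0 e = letter r 0 f"
  shows "e = f"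
proof -
  have eq1: "letter (j div m) 1 e = letter (j div m) 1 f"
    and eq2: "letter (j div m) 2 e = letter (j div m) 2 f" if "j < L" for j
    using eq[OF block_less[OF that]] by simp_all
  note home = home[unfolded letter_home[OF e] letter_home[OF f]]
  show ?thesis
  proof (cases e)
    case (G s)
    then show ?thesis
      using e f home eq1 by (cases f) (force simp: I_def letter_def)+
  next
    case (A j)
    then have j: "j < L" using e by (auto simp: I_def)
    show ?thesis
    proof (cases f)
      case (G s)
      then show ?thesis
        using A f home eq1[OF j] by (auto simp: I_def letter_def)
    next
      case (A i)
      then show ?thesis
        using \<open>e = A j\<close> home eq1[OF j] index_eq[of j i] by (auto simp: letter_def split: if_splits)
    qed (use A home in auto)
  next
    case (B j)
    then have j: "j < L" using e by (auto simp: I_def)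
    show ?thesis
    proof (cases f)
      case (G s)
      then show ?thesis
        using B f home by (auto simp: I_def)
    next
      case (B i)
      then show ?thesis
        using \<open>e = B j\<close> eq1[OF j] index_eq[of j i] by (auto simp: letter_def split: if_splits)
    qed (use B home eq1[OF j] in \<open>auto simp: letter_def\<close>)
  next
    case (C j)
    then have j: "j < L" using e by (auto simp: I_def)
    show ?thesis
    proof (cases f)
      case (G s)
      then show ?thesis
        using C f home by (auto simp: I_def)
    next
      case (C i)
      then show ?thesis
        using \<open>e = C j\<close> eq2[OF j] index_eq[of j i] by (auto simp: letter_def split: if_splits)
    qed (use C home eq2[OF j] in \<open>auto simp: letter_def\<close>)
  qed
qed

text \<open>Every type occurs on at least two legs, so a differing type yields a differing leg other
  than \<open>k\<close>.\<close>

lemma free: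
  assumes e: "e \<in> I" and f: "f \<in> I" and ne: "e \<noteq> f" and k: "k < d"
  shows "\<exists>l<d. l \<noteq> k \<and> X e ! l \<noteq> X f ! l"
proof -
  obtain tau where tau: "tau \<le> 3 * r" "letter (tau div 3) (tau mod 3) e \<noteq> letter (tau div 3) (tau mod 3) f"
  proof (cases "letter r 0 e = letter r 0 f")
    case True
    then obtain t c where "t < r" "c < 3" "letter t c e \<noteq> letter t c f"
      using letters_determine[OF e f] ne by blast
    then show ?thesis
      by (intro that[of "3 * t + c"]) auto
  next
    case False
    then show ?thesis
      by (intro that[of "3 * r"]) auto
  qed
  define l where "l = (if k = 2 * tau then 2 * tau + 1 else 2 * tau)"
  have "l < d" "l \<noteq> k" "leg_type l = tau"
    using tau(1) r_le by (auto simp: l_def leg_type_def)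
  then show ?thesis
    using tau(2) by (intro exI[of _ l]) (simp add: X_nth)
qed

section \<open>Weights for the joined ladders\<close>

definition x :: "nat \<Rightarrow> real" where "x j = 2 ^ (L - j) - 1"
definition y :: "nat \<Rightarrow> nat \<Rightarrow> real" where "y t a = (if a = 0 then 0 else x (t * m + a - 1))"

text \<open>\<open>x\<close> solves \<open>x j = 2 * x (Suc j) + 1\<close> with
  \<open>x L = 0\<close>. Before centring, \<open>B j\<close> and \<open>C j\<close> collect
  \<open>x j\<close> and \<open>-2 * x (Suc j)\<close>, and this has to match the total 1 that
  \<open>G\<close> and \<open>A\<close> get from the home type \<open>3 * r\<close>.\<close>

definition lam_type :: "nat \<Rightarrow> nat \<Rightarrow> real" where
  "lam_type tau a = (if tau = 3 * r then (if a = 0 then 0 else 1) - (real n - 1) / n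
    else (if tau mod 3 = 0 then -2 else 1) * (y (tau div 3) a - (\<Sum>b<n. y (tau div 3) b) / n))"

text \<open>A single leg of each type carries the weight, so that each type counts once.\<close>

definition lam :: "nat \<Rightarrow> nat \<Rightarrow> real" where
  "lam k a = (if even k \<and> k div 2 \<le> 3 * r then lam_type (k div 2) a else 0)"

lemma sum_lam: "(\<Sum>a<n. lam k a) = 0"
proof -
  have "{..<n} = insert 0 {1..<n}"
    using n by auto
  then have "(\<Sum>a<n. if a = 0 then 0 else 1 :: real) = (\<Sum>a\<in>{1..<n}. if a = 0 then 0 else 1)"
    by simp
  also have "\<dots> = (\<Sum>a\<in>{1..<n}. 1)"
    by (intro sum.cong) auto
  also have "\<dots> = real n - 1"
    using n by (simp add: of_nat_diff)
  finally have home: "(\<Sum>a<n. if a = 0 then 0 else 1 :: real) = real n - 1" .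
  have "(\<Sum>a<n. lam_type tau a) = 0" for tau
    using n home by (cases "tau = 3 * r") (simp_all add: lam_type_def sum_subtractf flip: sum_distrib_left)
  then show ?thesis
    by (cases "even k \<and> k div 2 \<le> 3 * r") (auto simp: lam_def intro!: sum.neutral)
qed

text \<open>The means subtracted in the three types of a block cancel, their coefficients being
  \<open>-2, 1, 1\<close>; only the mean of the home type remains.\<close>

lemma sum_lam_X:
  "(\<Sum>k<d. lam k (X e ! k)) = (\<Sum>t<r. y t (letter t 1 e) + y t (letter t 2 e) - 2 * y t (letter t 0 e))
    + (if letter r 0 e = 0 then 0 else 1) - (real n - 1) / n"
proof -
  let ?g = "\<lambda>tau. lam_type tau (letter (tau div 3) (tau mod 3) e)"
  have "(\<Sum>k<d. lam k (X e ! k)) = (\<Sum>k\<in>(\<lambda>tau. 2 * tau) ` {..3 * r}. lam k (X e ! k))"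
  proof (rule sum.mono_neutral_right)
    show "(\<lambda>tau. 2 * tau) ` {..3 * r} \<subseteq> {..<d}"
      using r_le by auto
    show "\<forall>k\<in>{..<d} - (\<lambda>tau. 2 * tau) ` {..3 * r}. lam k (X e ! k) = 0"
      by (force simp: lam_def elim!: evenE)
  qed simp
  also have "\<dots> = (\<Sum>tau\<le>3 * r. ?g tau)"
    using r_le by (subst sum.reindex) (auto simp: inj_on_def lam_def X_nth leg_type_def intro!: sum.cong)
  also have "\<dots> = (\<Sum>tau<r * 3. ?g tau) + ?g (3 * r)"
    by (simp add: lessThan_Suc_atMost[symmetric] mult.commute)
  also have "(\<Sum>tau<r * 3. ?g tau) = (\<Sum>t<r. sum ?g {t * 3..<t * 3 + 3})"
    by (rule sum.nat_group[symmetric])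
  also have "\<dots> = (\<Sum>t<r. y t (letter t 1 e) + y t (letter t 2 e) - 2 * y t (letter t 0 e))"
  proof (rule sum.cong[OF refl])
    fix t assume "t \<in> {..<r}"
    then have t: "t < r" by simp
    have dm: "(t * 3) div 3 = t" "(t * 3) mod 3 = 0" "(t * 3 + 1) div 3 = t" "(t * 3 + 1) mod 3 = 1"
      "(t * 3 + 2) div 3 = t" "(t * 3 + 2) mod 3 = 2"
      by presburger+
    have "{t * 3..<t * 3 + 3} = {t * 3, t * 3 + 1, t * 3 + 2}"
      by auto
    then have "sum ?g {t * 3..<t * 3 + 3} = ?g (t * 3) + ?g (t * 3 + 1) + ?g (t * 3 + 2)"
      by simp
    also have "\<dots> = y t (letter t 1 e) + y t (letter t 2 e) - 2 * y t (letter t 0 e)"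
      unfolding lam_type_def dm using t by (simp add: algebra_simps)
    finally show "sum ?g {t * 3..<t * 3 + 3} = y t (letter t 1 e) + y t (letter t 2 e) - 2 * y t (letter t 0 e)" .
  qed
  finally show ?thesis
    by (simp add: lam_type_def)
qed

lemma y_index: "j div m = t \<Longrightarrow> y t (S j) = x j"
  using index_of_letter[of j] by (auto simp: y_def)

lemma x_step: "j < L \<Longrightarrow> x j - 2 * (if Suc j < L then x (Suc j) else 0) = 1"
proof -
  assume j: "j < L"
  show ?thesis
  proof (cases "Suc j < L")
    case True
    then have "L - j = Suc (L - Suc j)"
      by simp
    then have "(2 :: real) ^ (L - j) = 2 * 2 ^ (L - Suc j)"
      by simp
    then show ?thesis
      using True by (simp add: x_def)
  next
    case False
    then have "L - j = 1" using j by simp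
    then show ?thesis
      using False by (simp add: x_def)
  qed
qed

text \<open>The indices \<open>j\<close> and \<open>Suc j\<close> may lie in different blocks, so
  the recursion of \<open>x\<close> shows only after summation over all blocks.\<close>

lemma sum_y_ladder:
  assumes j: "j < L"
  shows "(\<Sum>t<r. (if j div m = t then x j else 0)
    - 2 * (if Suc j < L \<and> Suc j div m = t then x (Suc j) else 0)) = 1"
proof -
  have "(\<Sum>t<r. if Suc j < L \<and> Suc j div m = t then x (Suc j) else 0) = (if Suc j < L then x (Suc j) else 0)"
    using block_less[of "Suc j"] by (cases "Suc j < L") simp_all
  moreover have "(\<Sum>t<r. if j div m = t then x j else 0) = x j"
    using block_less[OF j] by simp
  ultimately show ?thesis
    using x_step[OF j] by (simp only: sum_subtractf sum_distrib_left[symmetric])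
qed

text \<open>For \<open>G\<close> and \<open>A\<close> the three letters in a block agree, so the
  coefficients \<open>-2, 1, 1\<close> cancel and the home leg gives 1. \<open>B\<close> and
  \<open>C\<close> have home letter 0 and get 1 from the ladder. The home mean
  \<open>(n - 1) / n\<close> leaves \<open>1 / n\<close>.\<close>

lemma lam_X:
  assumes e: "e \<in> I"
  shows "(\<Sum>k<d. lam k (X e ! k)) = 1 / n"
proof -
  have "(\<Sum>t<r. y t (letter t 1 e) + y t (letter t 2 e) - 2 * y t (letter t 0 e))
    + (if letter r 0 e = 0 then 0 else 1) = 1"
  proof (cases e)
    case (G s)
    then show ?thesis
      using e by (auto simp: I_def letter_def)
  next
    case (A j)
    then have "j < L" using e by (auto simp: I_def)
    then show ?thesis
      using A block_less[of j] by (simp add: letter_def)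
  next
    case (B j)
    then have j: "j < L" using e by (auto simp: I_def)
    have "y t (letter t 1 e) + y t (letter t 2 e) - 2 * y t (letter t 0 e) = (if j div m = t then x j else 0)
        - 2 * (if Suc j < L \<and> Suc j div m = t then x (Suc j) else 0)" for t
      using B y_index[of j t] y_index[of "Suc j" t] by (auto simp: letter_def y_def[of _ 0])
    moreover have "letter r 0 e = 0"
      using B block_less[of "Suc j"] by (auto simp: letter_def)
    ultimately show ?thesis
      using sum_y_ladder[OF j] by simp
  next
    case (C j)
    then have j: "j < L" using e by (auto simp: I_def)
    have "y t (letter t 1 e) + y t (letter t 2 e) - 2 * y t (letter t 0 e) = (if j div m = t then x j else 0)
        - 2 * (if Suc j < L \<and> Suc j div m = t then x (Suc j) else 0)" for t
      using C y_index[of j t] y_index[of "Suc j" t] by (auto simp: letter_def y_def[of _ 0])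
    moreover have "letter r 0 e = 0"
      using C block_less[of "Suc j"] by (auto simp: letter_def)
    ultimately show ?thesis
      using sum_y_ladder[OF j] by simp
  qed
  then show ?thesis
    unfolding sum_lam_X using n by (simp add: field_simps)
qed

text \<open>The deviating legs 0 and 1 are the pair with \<open>t = c = 0\<close>; leg
  \<open>d - 1\<close> is a home leg and serves as the uniform one.\<close>

lemma tensor_near_uniform:
  "\<exists>v \<in> tensors n d. v \<noteq> zero_tensor \<and> zero_point \<notin> moment_polytope n d v \<and>
    dist_from_zero n d (moment_polytope n d v) \<le> a0"
  by (rule tensor_of_nearly_uniform_family[where I = I and X = X and q = q and lam = lam
        and c = "1 / n" and p = 0 and u = "d - 1"])
    (use n d finite_I q_pos X_multi_indices free sum_lam lam_X deviation a0_pos in auto)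

end

section \<open>The exponential bound on the gap\<close>

theorem theorem1p6:
  shows "\<exists>C::real. C > 0 \<and> (\<forall>d n :: nat. d \<ge> 3 \<longrightarrow> n \<ge> 2 \<longrightarrow>
    (\<exists>v \<in> tensors n d. v \<noteq> zero_tensor \<and> zero_point \<notin> moment_polytope n d v \<and>
       dist_from_zero n d (moment_polytope n d v) \<le> 2 powr (- (C * real d * real n))) \<and>
    gap n d \<le> 2 powr (- (C * real d * real n)))"
proof (intro exI[of _ "1 / 26 :: real"] conjI allI impI)
  fix d n :: nat assume d: "d \<ge> 3" and n: "n \<ge> 2"
  let ?bound = "2 powr (- (1 / 26 * real d * real n))"
  \<comment> \<open>The constant 26 comes from \<open>d \<le> 13 * r\<close> and
    \<open>n \<le> 2 * m\<close>, which give \<open>d * n \<le> 26 * L\<close>; for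
    \<open>d < 8\<close> it suffices that \<open>7 * n \<le> 26 * (n - 1)\<close>.\<close>
  have half_le: "(1 / 2 :: real) ^ k \<le> ?bound" if "d * n \<le> 26 * k" for k
  proof -
    have "real (d * n) \<le> real (26 * k)"
      using that by (simp only: of_nat_le_iff)
    then have "2 powr (- real k) \<le> ?bound"
      by simp
    then show ?thesis
      by (simp add: powr_minus powr_realpow power_one_over inverse_eq_divide)
  qed
  show ex: "\<exists>v \<in> tensors n d. v \<noteq> zero_tensor \<and> zero_point \<notin> moment_polytope n d v \<and>
      dist_from_zero n d (moment_polytope n d v) \<le> ?bound"
  proof (cases "d < 8")
    case True
    then have "d * n \<le> 7 * n" by simp
    also have "\<dots> \<le> 26 * (n - 1)" using n by simp
    finally show ?thesis
      using tensor_near_uniform_in_n[OF n d] half_le by (meson order.trans)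
  next
    case False
    then interpret block_ladder n d
      using n by unfold_locales simp_all
    have "d * n \<le> (13 * r) * (2 * m)"
      using r_ge n by (intro mult_mono) (simp_all add: m_def)
    also have "\<dots> = 26 * L"
      by (simp add: L_def)
    finally show ?thesis
      using tensor_near_uniform a0_le half_le by (meson order.trans)
  qed
  then obtain v where v: "v \<in> tensors n d" "v \<noteq> zero_tensor" "zero_point \<notin> moment_polytope n d v"
    "dist_from_zero n d (moment_polytope n d v) \<le> ?bound"
    by blast
  have "gap n d \<le> dist_from_zero n d (moment_polytope n d v)"
    unfolding gap_def
  proof (rule cInf_lower)
    \<comment> \<open>A real \<open>Inf\<close> is a lower bound only for a set bounded below; here
      0 bounds the distances, as every polytope in question is nonempty.\<close>
    show "bdd_below {dist_from_zero n d (moment_polytope n d v) | v.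
      v \<in> tensors n d \<and> v \<noteq> zero_tensor \<and> zero_point \<notin> moment_polytope n d v}"
      using moment_point_in_polytope by (intro bdd_belowI[of _ 0]) (auto intro!: dist_from_zero_nonneg)
  qed (use v in blast)
  then show "gap n d \<le> ?bound"
    using v(4) by linarith
qed simp

end
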